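(* Fix $0<\alpha<d$. For $t>-1$ let $r_t^{(n)}(x,y):=(1+t)\,\zeta_n^{-1}J(x,y)$, $x,y\in\mathbb{H}_L^d$. (a) (Purely subcritical regime) There exists $C>0$ depending only on $d$ and $L$ such that for every $\varepsilon\in(0,1)$, $$\mathbb{P}\big(|\mathcal{C}_1^{(n)}(r_{-\varepsilon}^{(n)})|\le C\,n\,\varepsilon^{-2}\big)\to 1\quad\text{as } n\to\infty .$$ (b) (Purely supercritical regime) Fix $\varepsilon>0$. Then there exists $C>0$ depending only on $\varepsilon,\alpha,A_1,A_2,d$ and $L$ such that $$\mathbb{P}\big(|\mathcal{C}_1^{(n)}(r_{\varepsilon}^{(n)})|\ge C\,L^{nd}\big)\to 1\quad\text{as } n\to\infty .$$
   Context: Let $d\ge 1$, $L\ge 2$ be integers. $\mathbb{H}_L^d$ is the direct sum of countably many copies of the abelian group $(\mathbb{Z}/L\mathbb{Z})^d$, i.e. the set of sequences $x=(x_i)_{i\ge 1}$ with $x_i\in(\mathbb{Z}/L\mathbb{Z})^d$ and $x_i=0$ for all but finitely many $i$. Set $\|0\|=0$, and $\|x\|=L^i$ if $x_i\ne 0$ and $x_j=0$ for all $j>i$; the distance between $x$ and $y$ is $\|x-y\|$. Let $\Lambda_n=\{x\in\mathbb{H}_L^d:\|x\|\le L^n\}$ for $n\ge 1$, so $|\Lambda_n|=L^{nd}$. Let $0<\alpha<d$, $0<A_1\le A_2$, and let $\rho:[0,\infty)\to[0,\infty)$ satisfy $\rho(0)=0$ and $A_1r^{-\alpha}\le\rho(r)\le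 A_2r^{-\alpha}$ for all $r\ge 1$. Let $J(x,y)=\rho(\|x-y\|)$. For $n\ge1$ with $L^{nd}>2$, $\zeta_n$ is the unique positive number satisfying $$(L^d-1)\sum_{i=1}^n L^{(i-1)d}\exp\big(-\zeta_n^{-1}\rho(L^i)\big)=L^{nd}-2 .$$ For a symmetric function $\kappa:\mathbb{H}_L^d\times\mathbb{H}_L^d\to[0,\infty)$, consider the random graph with vertex set $\Lambda_n$ obtained by placing edges independently between each pair $x\ne y\in\Lambda_n$ with probability $1-\exp(-\kappa(x,y))$; $\mathcal{C}_i^{(n)}(\kappa)$ denotes its $i$-th largest connected component (by number of vertices), and $|\mathcal{C}|$ denotes the number of vertices of $\mathcal{C}$. *)

theory Defs
  imports "HOL-Probability.Probability" "HOL-Algebra.Product_Groups"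
begin

section \<open>The hierarchical lattice\<close>

text \<open>An element is a sequence \<open>x\<close> indexed by \<open>i \<ge> 1\<close>, each \<open>x i\<close> being a \<open>d\<close>-tuple of
  residues in \<open>{0..<L}\<close> indexed by \<open>{1..d}\<close>.\<close>

definition torus_group :: "nat \<Rightarrow> nat \<Rightarrow> (nat \<Rightarrow> int) monoid" where
  "torus_group d L = product_group {1..d} (\<lambda>_. integer_mod_group L)"

definition hier_group :: "nat \<Rightarrow> nat \<Rightarrow> (nat \<Rightarrow> nat \<Rightarrow> int) monoid" where
  "hier_group d L = sum_group {1..} (\<lambda>_. torus_group d L)"

definition hier_norm :: "nat \<Rightarrow> nat \<Rightarrow> (nat \<Rightarrow> nat \<Rightarrow> int) \<Rightarrow> real" where
  "hier_norm d L x =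
     (if x = \<one>\<^bsub>hier_group d L\<^esub> then 0
      else real L ^ Max {i. i \<ge> 1 \<and> x i \<noteq> \<one>\<^bsub>torus_group d L\<^esub>})"

definition hier_dist :: "nat \<Rightarrow> nat \<Rightarrow> (nat \<Rightarrow> nat \<Rightarrow> int) \<Rightarrow> (nat \<Rightarrow> nat \<Rightarrow> int) \<Rightarrow> real" where
  "hier_dist d L x y =
     hier_norm d L (x \<otimes>\<^bsub>hier_group d L\<^esub> inv\<^bsub>hier_group d L\<^esub> y)"

definition hier_ball :: "nat \<Rightarrow> nat \<Rightarrow> nat \<Rightarrow> (nat \<Rightarrow> nat \<Rightarrow> int) set" where
  "hier_ball d L n = {x \<in> carrier (hier_group d L). hier_norm d L x \<le> real L ^ n}"

section \<open>Random graphs\<close>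

text \<open>The edge probability is meant for symmetric \<open>\<kappa>\<close> and a two-element set \<open>e\<close>, in which
  case the description below is satisfied by exactly one number; see \<open>edge_prob_doubleton\<close>.\<close>

definition edge_prob :: "('v \<Rightarrow> 'v \<Rightarrow> real) \<Rightarrow> 'v set \<Rightarrow> real" where
  "edge_prob \<kappa> e = (THE p. \<exists>x y. e = {x, y} \<and> p = 1 - exp (- \<kappa> x y))"

definition vertex_pairs :: "'v set \<Rightarrow> 'v set set" where
  "vertex_pairs V = {{x, y} | x y. x \<in> V \<and> y \<in> V \<and> x \<noteq> y}"

text \<open>The law of the random edge set, for a finite vertex set \<open>V\<close>.\<close>

definition random_graph :: "'v set \<Rightarrow> ('v \<Rightarrow> 'v \<Rightarrow> real) \<Rightarrow> 'v set set pmf" where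
  "random_graph V \<kappa> =
     map_pmf (\<lambda>\<omega>. {e \<in> vertex_pairs V. \<omega> e})
       (Pi_pmf (vertex_pairs V) False (\<lambda>e. bernoulli_pmf (edge_prob \<kappa> e)))"

definition components :: "'v set \<Rightarrow> 'v set set \<Rightarrow> 'v set set" where
  "components V E = V // {(x, y). x \<in> V \<and> y \<in> V \<and> (x, y) \<in> {(u, v). {u, v} \<in> E}\<^sup>*}"

text \<open>Ties are broken arbitrarily; this does not affect the number of vertices.\<close>

definition largest_component :: "'v set \<Rightarrow> 'v set set \<Rightarrow> 'v set" where
  "largest_component V E = (ARG_MAX card C. C \<in> components V E)"

section \<open>The kernels\<close>

text \<open>Only the values of \<open>\<rho>\<close> on nonnegative arguments are constrained or used.\<close>

definition admissible_rho :: "real \<Rightarrow> real \<Rightarrow> real \<Rightarrow> (real \<Rightarrow> real) \<Rightarrow> bool" where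
  "admissible_rho \<alpha> A\<^sub>1 A\<^sub>2 \<rho> \<longleftrightarrow>
     (\<forall>r\<ge>0. \<rho> r \<ge> 0) \<and> \<rho> 0 = 0 \<and>
     (\<forall>r\<ge>1. A\<^sub>1 * r powr (-\<alpha>) \<le> \<rho> r \<and> \<rho> r \<le> A\<^sub>2 * r powr (-\<alpha>))"

definition hier_kernel ::
    "nat \<Rightarrow> nat \<Rightarrow> (real \<Rightarrow> real) \<Rightarrow> (nat \<Rightarrow> nat \<Rightarrow> int) \<Rightarrow> (nat \<Rightarrow> nat \<Rightarrow> int) \<Rightarrow> real" where
  "hier_kernel d L \<rho> x y = \<rho> (hier_dist d L x y)"

text \<open>Meaningful when \<open>L ^ (n * d) > 2\<close>; see \<open>ex1_zeta\<close>.\<close>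

definition zeta :: "nat \<Rightarrow> nat \<Rightarrow> (real \<Rightarrow> real) \<Rightarrow> nat \<Rightarrow> real" where
  "zeta d L \<rho> n =
     (THE z. z > 0 \<and>
        (real L ^ d - 1) *
          (\<Sum>i=1..n. real L ^ ((i - 1) * d) * exp (- (inverse z * \<rho> (real L ^ i))))
        = real L ^ (n * d) - 2)"

definition near_critical_kernel ::
    "nat \<Rightarrow> nat \<Rightarrow> (real \<Rightarrow> real) \<Rightarrow> real \<Rightarrow> nat \<Rightarrow>
     (nat \<Rightarrow> nat \<Rightarrow> int) \<Rightarrow> (nat \<Rightarrow> nat \<Rightarrow> int) \<Rightarrow> real" where
  "near_critical_kernel d L \<rho> t n x y =
     (1 + t) * inverse (zeta d L \<rho> n) * hier_kernel d L \<rho> x y"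

section \<open>Well-definedness\<close>

lemma edge_prob_doubleton:
  assumes "\<And>u v. u \<in> {x, y} \<Longrightarrow> v \<in> {x, y} \<Longrightarrow> \<kappa> u v = \<kappa> v u" "x \<noteq> y"
  shows "edge_prob \<kappa> {x, y} = 1 - exp (- \<kappa> x y)"
  unfolding edge_prob_def using assms by (intro the_equality) (auto simp: doubleton_eq_iff)

lemma group_torus_group: "group (torus_group d L)"
  by (simp add: torus_group_def)

lemma group_hier_group: "group (hier_group d L)"
  by (simp add: hier_group_def group_torus_group)

lemma carrier_hier_group:
  "carrier (hier_group d L) =
     {x \<in> {1..} \<rightarrow>\<^sub>E carrier (torus_group d L). finite {i \<in> {1..}. x i \<noteq> \<one>\<^bsub>torus_group d L\<^esub>}}"
  unfolding hier_group_def by (rule carrier_sum_group) (rule group_torus_group)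

lemma hier_dist_commute:
  assumes x: "x \<in> carrier (hier_group d L)" and y: "y \<in> carrier (hier_group d L)"
  shows "hier_dist d L x y = hier_dist d L y x"
proof -
  interpret H: group "hier_group d L" by (rule group_hier_group)
  interpret T: group "torus_group d L" by (rule group_torus_group)
  have norm_inv: "hier_norm d L (inv\<^bsub>hier_group d L\<^esub> z) = hier_norm d L z"
    if z: "z \<in> carrier (hier_group d L)" for z
  proof -
    have "inv\<^bsub>hier_group d L\<^esub> z = (\<lambda>i\<in>{1..}. inv\<^bsub>torus_group d L\<^esub> z i)"
      using z unfolding hier_group_def by (intro inv_sum_group) (auto simp: group_torus_group)
    moreover have "z i \<in> carrier (torus_group d L)" if "i \<ge> 1" for i
      using z that by (auto simp: carrier_hier_group PiE_iff)
    ultimately have "{i. i \<ge> 1 \<and> (inv\<^bsub>hier_group d L\<^esub> z) i \<noteq> \<one>\<^bsub>torus_group d L\<^esub>}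
        = {i. i \<ge> 1 \<and> z i \<noteq> \<one>\<^bsub>torus_group d L\<^esub>}"
      by (auto simp: T.inv_eq_1_iff)
    then show ?thesis
      using z by (simp add: hier_norm_def H.inv_eq_1_iff)
  qed
  show ?thesis
    using norm_inv[of "x \<otimes>\<^bsub>hier_group d L\<^esub> inv\<^bsub>hier_group d L\<^esub> y"] x y
    by (simp add: hier_dist_def H.inv_mult_group)
qed

lemma hier_norm_le_iff:
  assumes x: "x \<in> carrier (hier_group d L)" and L: "L \<ge> 2"
  shows "hier_norm d L x \<le> real L ^ n \<longleftrightarrow> (\<forall>i>n. i \<ge> 1 \<longrightarrow> x i = \<one>\<^bsub>torus_group d L\<^esub>)"
proof (cases "x = \<one>\<^bsub>hier_group d L\<^esub>")
  case True
  then show ?thesis by (auto simp: hier_norm_def hier_group_def)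
next
  case False
  let ?S = "{i. i \<ge> 1 \<and> x i \<noteq> \<one>\<^bsub>torus_group d L\<^esub>}"
  have "finite ?S" using x by (simp add: carrier_hier_group)
  moreover have "?S \<noteq> {}"
  proof
    assume "?S = {}"
    then have "x = (\<lambda>i\<in>{1..}. \<one>\<^bsub>torus_group d L\<^esub>)"
      using x by (auto simp: carrier_hier_group PiE_iff extensional_def fun_eq_iff)
    with False show False by (simp add: hier_group_def)
  qed
  ultimately have "Max ?S \<le> n \<longleftrightarrow> (\<forall>i\<in>?S. i \<le> n)" by simp
  moreover have "hier_norm d L x \<le> real L ^ n \<longleftrightarrow> Max ?S \<le> n"
    using False L by (simp add: hier_norm_def)
  moreover have "(\<forall>i\<in>?S. i \<le> n) \<longleftrightarrow> (\<forall>i>n. i \<ge> 1 \<longrightarrow> x i = \<one>\<^bsub>torus_group d L\<^esub>)"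
    using not_less by blast
  ultimately show ?thesis by simp
qed

lemma card_hier_ball:
  assumes L: "L \<ge> 2"
  shows "card (hier_ball d L n) = L ^ (n * d)" and "finite (hier_ball d L n)"
proof -
  let ?T = "carrier (torus_group d L)"
  have T: "?T = {1..d} \<rightarrow>\<^sub>E {0..<int L}"
    using L by (simp add: torus_group_def carrier_integer_mod_group)
  have finT: "finite ?T" unfolding T by (intro finite_PiE) auto
  have cardT: "card ?T = L ^ d" unfolding T by (simp add: card_PiE)
  have one: "\<one>\<^bsub>torus_group d L\<^esub> \<in> ?T"
    using group_torus_group group.is_monoid monoid.one_closed by blast
  have "bij_betw (\<lambda>x. restrict x {1..n}) (hier_ball d L n) ({1..n} \<rightarrow>\<^sub>E ?T)"
  proof (rule bij_betwI[where g = "\<lambda>x. \<lambda>i\<in>{1..}. if i \<le> n then x i else \<one>\<^bsub>torus_group d L\<^esub>"])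
    show "(\<lambda>x. restrict x {1..n}) \<in> hier_ball d L n \<rightarrow> ({1..n} \<rightarrow>\<^sub>E ?T)"
      by (auto simp: hier_ball_def carrier_hier_group PiE_iff)
    show "(\<lambda>x. \<lambda>i\<in>{1..}. if i \<le> n then x i else \<one>\<^bsub>torus_group d L\<^esub>) \<in> ({1..n} \<rightarrow>\<^sub>E ?T) \<rightarrow> hier_ball d L n"
    proof
      fix x assume x: "x \<in> {1..n} \<rightarrow>\<^sub>E ?T"
      let ?g = "\<lambda>i\<in>{1..}. if i \<le> n then x i else \<one>\<^bsub>torus_group d L\<^esub>"
      have "finite {i \<in> {1..}. ?g i \<noteq> \<one>\<^bsub>torus_group d L\<^esub>}"
        by (rule finite_subset[of _ "{..n}"]) (auto split: if_splits)
      then have "?g \<in> carrier (hier_group d L)"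
        using x one by (auto simp: carrier_hier_group PiE_iff)
      then show "?g \<in> hier_ball d L n"
        using L by (auto simp: hier_ball_def hier_norm_le_iff)
    qed
    show "(\<lambda>i\<in>{1..}. if i \<le> n then (restrict x {1..n}) i else \<one>\<^bsub>torus_group d L\<^esub>) = x"
      if "x \<in> hier_ball d L n" for x
      using that L
      by (auto simp: hier_ball_def hier_norm_le_iff carrier_hier_group PiE_iff extensional_def fun_eq_iff)
    show "restrict (\<lambda>i\<in>{1..}. if i \<le> n then x i else \<one>\<^bsub>torus_group d L\<^esub>) {1..n} = x"
      if "x \<in> {1..n} \<rightarrow>\<^sub>E ?T" for x
      using that by (auto simp: PiE_iff extensional_def fun_eq_iff)
  qed
  then show "card (hier_ball d L n) = L ^ (n * d)" "finite (hier_ball d L n)"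
    using finT by (auto simp: bij_betw_same_card card_PiE cardT power_mult mult.commute
      bij_betw_finite intro: finite_PiE)
qed

lemma ex1_zeta:
  assumes L: "L \<ge> 2" and d: "d \<ge> 1" and n: "L ^ (n * d) > 2"
    and A: "0 < A\<^sub>1" and \<rho>: "admissible_rho \<alpha> A\<^sub>1 A\<^sub>2 \<rho>"
  shows "\<exists>!z. z > 0 \<and>
        (real L ^ d - 1) *
          (\<Sum>i=1..n. real L ^ ((i - 1) * d) * exp (- (inverse z * \<rho> (real L ^ i))))
        = real L ^ (n * d) - 2"
proof -
  define F where "F s = (real L ^ d - 1) *
     (\<Sum>i=1..n. real L ^ ((i - 1) * d) * exp (- (s * \<rho> (real L ^ i))))" for s
  have Ld: "real L ^ d > 1" using L d by (intro one_less_power) auto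
  have pos: "\<rho> (real L ^ i) > 0" for i
  proof -
    have "real L ^ i \<ge> 1" using L by (intro one_le_power) auto
    then have "A\<^sub>1 * (real L ^ i) powr (-\<alpha>) \<le> \<rho> (real L ^ i)" "(real L ^ i) powr (-\<alpha>) > 0"
      using \<rho> L by (auto simp: admissible_rho_def)
    then show ?thesis using A by (smt (verit) mult_pos_pos)
  qed
  have n0: "n \<noteq> 0" using n by (cases n) auto
  have N: "real L ^ (n * d) > 2"
    using n by (metis of_nat_less_iff of_nat_numeral of_nat_power)
  have F0: "F 0 = real L ^ (n * d) - 1"
  proof -
    have "(\<Sum>i=1..n. real L ^ ((i - 1) * d)) = (\<Sum>i<n. (real L ^ d) ^ i)"
      by (rule sum.reindex_bij_witness[of _ Suc "\<lambda>i. i - 1"]) (auto simp: power_mult mult.commute[of _ d])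
    also have "(real L ^ d - 1) * \<dots> = (real L ^ d) ^ n - 1"
      by (rule power_diff_1_eq[symmetric])
    finally show ?thesis by (simp add: F_def power_mult mult.commute[of n d])
  qed
  have anti: "F t < F s" if "s < t" for s t
    unfolding F_def using Ld n0 pos that L
    by (intro mult_strict_left_mono sum_strict_mono) auto
  have cont: "continuous_on A F" for A
    unfolding F_def by (intro continuous_intros)
  have "(F \<longlongrightarrow> (real L ^ d - 1) * (\<Sum>i=1..n. real L ^ ((i - 1) * d) * 0)) at_top"
    unfolding F_def
  proof (intro tendsto_intros)
    fix i
    have "filterlim (\<lambda>s. s * \<rho> (real L ^ i)) at_top at_top"
      using pos[of i] by (intro filterlim_at_top_mult_tendsto_pos[OF tendsto_const _ filterlim_ident])
    then show "((\<lambda>s. exp (- (s * \<rho> (real L ^ i)))) \<longlongrightarrow> 0) at_top"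
      by (intro filterlim_compose[OF exp_at_bot]) (simp add: filterlim_uminus_at_top)
  qed
  then have "(F \<longlongrightarrow> 0) at_top" by simp
  then have "eventually (\<lambda>s. F s < real L ^ (n * d) - 2) at_top"
    using N by (intro order_tendstoD) auto
  then obtain T where T: "\<And>s. s \<ge> T \<Longrightarrow> F s < real L ^ (n * d) - 2"
    unfolding eventually_at_top_linorder by blast
  have "\<exists>s. 0 \<le> s \<and> s \<le> max T 1 \<and> F s = real L ^ (n * d) - 2"
  proof (rule IVT2')
    show "F (max T 1) \<le> real L ^ (n * d) - 2" using T[of "max T 1"] by simp
    show "real L ^ (n * d) - 2 \<le> F 0" by (simp add: F0)
  qed (auto simp: cont)
  then obtain s where s: "0 \<le> s" "F s = real L ^ (n * d) - 2" by blast
  have "s \<noteq> 0" using s F0 by auto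
  show ?thesis
  proof (rule ex1I[of _ "inverse s"])
    show "inverse s > 0 \<and> (real L ^ d - 1) *
          (\<Sum>i=1..n. real L ^ ((i - 1) * d) * exp (- (inverse (inverse s) * \<rho> (real L ^ i))))
        = real L ^ (n * d) - 2"
      using s \<open>s \<noteq> 0\<close> by (simp add: F_def)
  next
    fix z assume z: "z > 0 \<and> (real L ^ d - 1) *
          (\<Sum>i=1..n. real L ^ ((i - 1) * d) * exp (- (inverse z * \<rho> (real L ^ i))))
        = real L ^ (n * d) - 2"
    then have "F (inverse z) = F s" using s by (simp add: F_def)
    then have "inverse z = s" using anti by (metis less_irrefl linorder_neqE)
    then show "z = inverse s" by auto
  qed
qed

end

theory Submission
  imports Defs
begin

text \<open>
  Write \<open>N = L ^ (n * d)\<close>. The number \<open>zeta\<close> is chosen so that every vertex of the ball has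
  expected degree exactly one under the kernel \<open>\<zeta>\<inverse> J\<close>. Since \<open>\<alpha> < d\<close>, all entries of this
  kernel tend to zero as \<open>n\<close> grows, so \<open>1 - exp (- k)\<close> is uniformly close to \<open>k\<close> and multiplying
  the kernel by \<open>1 + t\<close> multiplies the expected degrees asymptotically by \<open>1 + t\<close>
  (\<open>subcritical_degree\<close>, \<open>supercritical_degree\<close>). What remains is a statement about random graphs
  with independent edges on a finite vertex set, and both halves of it come from exploring the graph
  one vertex at a time.

  A state of the exploration is a set \<open>V\<close> of vertices not yet explored and a set \<open>A \<subseteq> V\<close> of active
  ones. Exploring an active vertex \<open>a\<close> means deleting it from \<open>V\<close> and adding its neighbours in
  \<open>V - A\<close> to the active set. The edges among the vertices that are left have not been looked at and
  are independent of everything seen so far. So if a functional of the graph is bounded in terms of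
  the same functional of the smaller graph, and the expectation of the latter is at most \<open>K * g ^ b\<close>
  when there are \<open>b\<close> new active vertices, then its expectation is at most
  \<open>K * (\<Prod>y\<in>V - A. 1 + p {a, y} * (g - 1)) \<le> K * exp ((g - 1) * (\<Sum>y\<in>V - A. p {a, y}))\<close>.
  This is \<open>exploration_step\<close>, and it is iterated in two ways.

  In the subcritical case the functional is \<open>\<theta> ^ card C\<close>, where \<open>\<theta> > 1\<close> and \<open>C\<close> is the set of
  vertices connected to \<open>A\<close>. If all expected degrees are at most \<open>\<mu>\<close> and
  \<open>\<theta> * exp (\<mu> * (g - 1)) \<le> g\<close>, then its expectation is at most \<open>g ^ card A\<close>. For
  \<open>\<mu> = 1 - \<eta>\<close> one may take \<open>\<theta> = exp (\<eta>\<^sup>2 / 4)\<close>; Markov's inequality and a union bound over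
  the \<open>N\<close> vertices then bound all components by a multiple of \<open>ln N / \<eta>\<^sup>2\<close>, and \<open>ln N\<close> is
  proportional to \<open>n\<close>.

  In the supercritical case the functional is the indicator of the event that no component reaches
  size \<open>M\<close>. If the exploration restarts at a fresh vertex whenever the active set runs empty, the
  number of active vertices is at least a random walk whose drift stays positive as long as only a
  small fraction of the vertices has been discovered. All active vertices lie in one component; on
  the event in question there are thus always fewer than \<open>M\<close> of them, and a random walk with
  positive drift stays that low for a large multiple of \<open>M\<close> steps only with exponentially small
  probability. Here \<open>M\<close> may be proportional to \<open>N\<close>, because of \<open>degree_loss_le\<close>: the hypothesis
  \<open>\<alpha> < d\<close> makes most of the degree of a vertex come from the largest distances, where the edge
  probabilities are of order \<open>1 / N\<close>, so that discarding a small fraction of the vertices lowers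
  every expected degree only slightly.
\<close>

section \<open>Random edge sets\<close>

text \<open>The edge set \<open>D\<close> is arbitrary, rather than the set of all pairs of vertices, so that the law can
  be restricted to parts of the graph.\<close>

definition random_edges :: "'v set set \<Rightarrow> ('v set \<Rightarrow> real) \<Rightarrow> 'v set set pmf" where
  "random_edges D p =
     map_pmf (\<lambda>\<omega>. {e \<in> D. \<omega> e}) (Pi_pmf D False (\<lambda>e. bernoulli_pmf (p e)))"

lemma random_graph_eq_random_edges: "random_graph V \<kappa> = random_edges (vertex_pairs V) (edge_prob \<kappa>)"
  by (simp add: random_graph_def random_edges_def)

lemma set_random_edges: "set_pmf (random_edges D p) \<subseteq> Pow D"
  by (auto simp: random_edges_def)

lemma finite_set_random_edges: "finite D \<Longrightarrow> finite (set_pmf (random_edges D p))"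
  using set_random_edges by (rule finite_subset) simp

lemma integrable_random_edges:
  "finite D \<Longrightarrow> integrable (measure_pmf (random_edges D p)) (f :: 'v set set \<Rightarrow> real)"
  by (intro integrable_measure_pmf_finite finite_set_random_edges)

lemma random_edges_subset:
  assumes "finite D" "D' \<subseteq> D"
  shows "random_edges D' p = map_pmf (\<lambda>E. E \<inter> D') (random_edges D p)"
  unfolding random_edges_def Pi_pmf_subset[OF assms]
  by (simp add: map_pmf_comp, intro map_pmf_cong) (use assms in auto)

lemma random_edges_Un:
  assumes "finite D1" "finite D2" "D1 \<inter> D2 = {}"
  shows "random_edges (D1 \<union> D2) p =
    map_pmf (\<lambda>(E, F). E \<union> F) (pair_pmf (random_edges D1 p) (random_edges D2 p))"
  unfolding random_edges_def Pi_pmf_union[OF assms] map_pair[symmetric] map_pmf_comp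
  using assms by (intro map_pmf_cong) (auto simp: case_prod_beta split: if_splits)

lemma expectation_pair_pmf_finite:
  fixes f :: "'a \<Rightarrow> 'b \<Rightarrow> real"
  assumes "finite (set_pmf p)" "finite (set_pmf q)"
  shows "measure_pmf.expectation (pair_pmf p q) (\<lambda>(x, y). f x y) =
    measure_pmf.expectation p (\<lambda>x. measure_pmf.expectation q (f x))"
proof -
  have "pair_pmf p q = bind_pmf p (\<lambda>x. map_pmf (Pair x) q)"
    by (simp add: pair_pmf_def map_pmf_def)
  then have "measure_pmf.expectation (pair_pmf p q) (\<lambda>(x, y). f x y) =
     (\<Sum>a\<in>set_pmf p. pmf p a *\<^sub>R measure_pmf.expectation (map_pmf (Pair a) q) (\<lambda>(x, y). f x y))"
    using assms by (simp only:) (intro pmf_expectation_bind, auto)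
  also have "\<dots> = measure_pmf.expectation p (\<lambda>x. measure_pmf.expectation q (f x))"
    using assms by (subst integral_measure_pmf[OF assms(1)]) auto
  finally show ?thesis .
qed

text \<open>The generating function of a sum of independent Bernoulli variables is the product of theirs.\<close>

lemma expectation_power_card_random_edges:
  fixes g :: real
  assumes D: "finite D" and p: "\<And>e. e \<in> D \<Longrightarrow> 0 \<le> p e \<and> p e \<le> 1" and g: "0 \<le> g"
  shows "measure_pmf.expectation (random_edges D p) (\<lambda>E. g ^ card E) =
    (\<Prod>e\<in>D. 1 + p e * (g - 1))"
proof -
  have pow: "g ^ card {e \<in> D. \<omega> e} = (\<Prod>e\<in>D. if \<omega> e then g else 1)" for \<omega>
    using D by (simp add: prod.If_cases Int_def)
  have "measure_pmf.expectation (random_edges D p) (\<lambda>E. g ^ card E) =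
      (\<Prod>e\<in>D. measure_pmf.expectation (bernoulli_pmf (p e)) (\<lambda>b. if b then g else 1))"
    unfolding random_edges_def integral_map_pmf pow
    using D g by (intro expectation_prod_Pi_pmf) (auto intro!: integrable_measure_pmf_finite)
  also have "\<dots> = (\<Prod>e\<in>D. 1 + p e * (g - 1))"
    using p by (intro prod.cong) (auto simp: algebra_simps)
  finally show ?thesis .
qed

section \<open>Exploring one vertex\<close>

lemma finite_vertex_pairs: "finite V \<Longrightarrow> finite (vertex_pairs V)"
  by (rule finite_subset[of _ "Pow V"]) (auto simp: vertex_pairs_def)

definition new_neighbours :: "'v set \<Rightarrow> 'v set \<Rightarrow> 'v \<Rightarrow> 'v set set \<Rightarrow> 'v set" where
  "new_neighbours V A a E = {y \<in> V - A. {a, y} \<in> E}"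

text \<open>Only two disjoint sets of edges matter: the edges from \<open>a\<close> to \<open>V - A\<close>, which determine the new
  active vertices, and the edges avoiding \<open>a\<close>, which form the graph that remains. Edges from \<open>a\<close> to
  the rest of \<open>A\<close> are integrated out. By independence one may average over the remaining graph first,
  which gives \<open>K * g ^ b\<close> with \<open>b\<close> the number of new active vertices, and then over the edges at \<open>a\<close>,
  which turns \<open>g ^ b\<close> into the product.\<close>

lemma exploration_step:
  fixes f :: "'v set set \<Rightarrow> real" and h :: "'v set \<Rightarrow> 'v set set \<Rightarrow> real"
  assumes V: "finite V" and A: "A \<subseteq> V" and a: "a \<in> A"
    and p: "\<And>e. e \<in> vertex_pairs V \<Longrightarrow> 0 \<le> p e \<and> p e \<le> 1"
    and g: "0 \<le> g"
    and f: "\<And>E. E \<subseteq> vertex_pairs V \<Longrightarrow> f E \<le> h (new_neighbours V A a E) {e \<in> E. a \<notin> e}"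
    and h: "\<And>B. B \<subseteq> V - A \<Longrightarrow>
      measure_pmf.expectation (random_edges (vertex_pairs (V - {a})) p) (h B) \<le> K * g ^ card B"
  shows "measure_pmf.expectation (random_edges (vertex_pairs V) p) f
    \<le> K * (\<Prod>y\<in>V - A. 1 + p {a, y} * (g - 1))"
proof -
  let ?D = "vertex_pairs V" and ?D2 = "vertex_pairs (V - {a})"
  let ?star = "(\<lambda>y. {a, y}) ` (V - A)"
  let ?N = "new_neighbours V A a"
  have fin: "finite ?D" "finite ?D2" "finite ?star"
    using V by (auto intro: finite_vertex_pairs)
  have star: "?star \<subseteq> ?D" using A a by (auto simp: vertex_pairs_def)
  have sub: "?star \<union> ?D2 \<subseteq> ?D"
    using star by (auto simp: vertex_pairs_def)
  have disj: "?star \<inter> ?D2 = {}" by (auto simp: vertex_pairs_def doubleton_eq_iff)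
  have inj: "inj_on (\<lambda>y. {a, y}) (V - A)"
    using a by (auto simp: inj_on_def doubleton_eq_iff)
  have D2_iff: "e \<in> ?D2 \<longleftrightarrow> e \<in> ?D \<and> a \<notin> e" for e
    by (auto simp: vertex_pairs_def)
  have N_star: "?N (E \<union> F) = ?N E" if "F \<subseteq> ?D2" for E F
    using that by (auto simp: new_neighbours_def D2_iff)
  have "measure_pmf.expectation (random_edges ?D p) f \<le>
      measure_pmf.expectation (random_edges ?D p) (\<lambda>E. h (?N (E \<inter> (?star \<union> ?D2))) (E \<inter> (?star \<union> ?D2) \<inter> ?D2))"
  proof (intro integral_mono_AE integrable_random_edges fin AE_pmfI)
    fix E assume "E \<in> set_pmf (random_edges ?D p)"
    then have E: "E \<subseteq> ?D" using set_random_edges by blast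
    have "?N (E \<inter> (?star \<union> ?D2)) = ?N E" by (auto simp: new_neighbours_def)
    moreover have "E \<inter> (?star \<union> ?D2) \<inter> ?D2 = {e \<in> E. a \<notin> e}"
      using E by (auto simp: D2_iff)
    ultimately show "f E \<le> h (?N (E \<inter> (?star \<union> ?D2))) (E \<inter> (?star \<union> ?D2) \<inter> ?D2)"
      using f[OF E] by simp
  qed
  also have "\<dots> = measure_pmf.expectation (random_edges (?star \<union> ?D2) p) (\<lambda>E. h (?N E) (E \<inter> ?D2))"
    by (simp add: random_edges_subset[OF fin(1) sub])
  also have "\<dots> = measure_pmf.expectation (pair_pmf (random_edges ?star p) (random_edges ?D2 p))
      (\<lambda>(E, F). h (?N (E \<union> F)) ((E \<union> F) \<inter> ?D2))"
    by (simp add: random_edges_Un[OF fin(3,2) disj] case_prod_unfold)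
  also have "\<dots> = measure_pmf.expectation (pair_pmf (random_edges ?star p) (random_edges ?D2 p))
      (\<lambda>(E, F). h (?N E) F)"
  proof (intro integral_cong_AE AE_pmfI)
    fix z assume "z \<in> set_pmf (pair_pmf (random_edges ?star p) (random_edges ?D2 p))"
    then obtain E F where z: "z = (E, F)" "E \<in> set_pmf (random_edges ?star p)"
        "F \<in> set_pmf (random_edges ?D2 p)"
      by (auto simp del: set_map_pmf)
    then have "E \<subseteq> ?star" "F \<subseteq> ?D2"
      using set_random_edges by blast+
    then have "(E \<union> F) \<inter> ?D2 = F" using disj by auto
    then show "(case z of (E, F) \<Rightarrow> h (?N (E \<union> F)) ((E \<union> F) \<inter> ?D2)) = (case z of (E, F) \<Rightarrow> h (?N E) F)"
      using z(1) N_star[OF \<open>F \<subseteq> ?D2\<close>, of E] by simp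
  qed auto
  also have "\<dots> = measure_pmf.expectation (random_edges ?star p)
      (\<lambda>E. measure_pmf.expectation (random_edges ?D2 p) (h (?N E)))"
    using fin by (intro expectation_pair_pmf_finite finite_set_random_edges)
  also have "\<dots> \<le> measure_pmf.expectation (random_edges ?star p) (\<lambda>E. K * g ^ card E)"
  proof (intro integral_mono_AE integrable_random_edges fin AE_pmfI)
    fix E assume "E \<in> set_pmf (random_edges ?star p)"
    then have E: "E \<subseteq> ?star" using set_random_edges by blast
    have N: "?N E \<subseteq> V - A" by (auto simp: new_neighbours_def)
    have "E = (\<lambda>y. {a, y}) ` ?N E" using E by (auto simp: new_neighbours_def)
    also have "card \<dots> = card (?N E)" by (rule card_image[OF inj_on_subset[OF inj N]])
    finally show "measure_pmf.expectation (random_edges ?D2 p) (h (?N E)) \<le> K * g ^ card E"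
      using h[OF N] by simp
  qed
  also have "\<dots> = K * measure_pmf.expectation (random_edges ?star p) (\<lambda>E. g ^ card E)"
    by simp
  also have "measure_pmf.expectation (random_edges ?star p) (\<lambda>E. g ^ card E) =
      (\<Prod>e\<in>?star. 1 + p e * (g - 1))"
    using star p by (intro expectation_power_card_random_edges fin g) blast
  also have "\<dots> = (\<Prod>y\<in>V - A. 1 + p {a, y} * (g - 1))"
    using inj by (simp add: prod.reindex)
  finally show ?thesis .
qed

lemma prod_one_plus_le_exp:
  fixes p :: "'a \<Rightarrow> real"
  assumes "\<And>y. y \<in> S \<Longrightarrow> 0 \<le> 1 + p y * c"
  shows "(\<Prod>y\<in>S. 1 + p y * c) \<le> exp (c * (\<Sum>y\<in>S. p y))"
proof (cases "finite S")
  case True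
  have "(\<Prod>y\<in>S. 1 + p y * c) \<le> (\<Prod>y\<in>S. exp (p y * c))"
    using assms by (intro prod_mono) auto
  also have "\<dots> = exp (c * (\<Sum>y\<in>S. p y))"
    using True by (simp add: exp_sum sum_distrib_left mult.commute)
  finally show ?thesis .
qed auto

section \<open>Reachable sets and components\<close>

definition reach :: "'v set set \<Rightarrow> 'v set \<Rightarrow> 'v set" where
  "reach E A = {(u, v). {u, v} \<in> E}\<^sup>* `` A"

lemma reach_least:
  assumes "A \<subseteq> S" "\<And>u v. u \<in> S \<Longrightarrow> {u, v} \<in> E \<Longrightarrow> v \<in> S"
  shows "reach E A \<subseteq> S"
proof
  fix y assume "y \<in> reach E A"
  then obtain x where x: "x \<in> A" and xy: "(x, y) \<in> {(u, v). {u, v} \<in> E}\<^sup>*"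
    by (auto simp: reach_def)
  from xy show "y \<in> S"
    by (induction rule: rtrancl_induct) (use x assms in auto)
qed

lemma subset_reach: "A \<subseteq> reach E A"
  by (auto simp: reach_def)

lemma reach_closed: "u \<in> reach E A \<Longrightarrow> {u, v} \<in> E \<Longrightarrow> v \<in> reach E A"
  by (auto simp: reach_def intro: rtrancl.rtrancl_into_rtrancl)

lemma reach_mono: "E \<subseteq> F \<Longrightarrow> A \<subseteq> B \<Longrightarrow> reach E A \<subseteq> reach F B"
  by (rule reach_least) (use subset_reach[of B F] reach_closed[of _ F B] in blast)+

lemma reach_vertex_pairs: "E \<subseteq> vertex_pairs V \<Longrightarrow> A \<subseteq> V \<Longrightarrow> reach E A \<subseteq> V"
  by (rule reach_least) (auto simp: vertex_pairs_def doubleton_eq_iff)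

text \<open>Deleting the active vertex \<open>a\<close> disconnects nothing that matters, since everything that \<open>a\<close> leads
  to directly is active afterwards.\<close>

lemma reach_explore:
  assumes E: "E \<subseteq> vertex_pairs V" and A: "A \<subseteq> V" and a: "a \<in> A"
  shows "reach E A = insert a (reach {e \<in> E. a \<notin> e} (A - {a} \<union> new_neighbours V A a E))"
    (is "_ = insert a ?R")
    and "a \<notin> reach {e \<in> E. a \<notin> e} (A - {a} \<union> new_neighbours V A a E)"
proof -
  let ?B = "new_neighbours V A a E"
  have no_loop: "u \<noteq> v \<and> v \<in> V" if "{u, v} \<in> E" for u v
    using that E by (auto simp: vertex_pairs_def doubleton_eq_iff)
  have "A - {a} \<union> ?B \<subseteq> ?R" by (rule subset_reach)
  have "reach E A \<subseteq> insert a ?R"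
  proof (rule reach_least)
    show "A \<subseteq> insert a ?R" using \<open>A - {a} \<union> ?B \<subseteq> ?R\<close> by blast
    fix u v assume u: "u \<in> insert a ?R" and uv: "{u, v} \<in> E"
    show "v \<in> insert a ?R"
    proof (cases "u = a \<or> v = a")
      case True
      with no_loop[OF uv] uv \<open>A - {a} \<union> ?B \<subseteq> ?R\<close> show ?thesis
        by (auto simp: new_neighbours_def)
    next
      case False
      with u uv show ?thesis by (auto intro: reach_closed)
    qed
  qed
  moreover have "?B \<subseteq> reach E A"
    using a subset_reach[of A E] by (auto simp: new_neighbours_def intro: reach_closed)
  then have "?R \<subseteq> reach E A"
    by (intro reach_least) (use subset_reach[of A E] reach_closed[of _ E A] in auto)
  ultimately show "reach E A = insert a ?R"
    using a subset_reach[of A E] by blast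
  have "?R \<subseteq> - {a}"
    using a by (intro reach_least) (auto simp: new_neighbours_def)
  then show "a \<notin> ?R" by blast
qed

lemma card_reach_explore:
  assumes V: "finite V" and E: "E \<subseteq> vertex_pairs V" and A: "A \<subseteq> V" and a: "a \<in> A"
  shows "card (reach E A) =
    Suc (card (reach {e \<in> E. a \<notin> e} (A - {a} \<union> new_neighbours V A a E)))"
proof -
  have "finite (reach E A)"
    using reach_vertex_pairs[OF E A] V by (rule finite_subset)
  then show ?thesis
    using reach_explore[OF E A a] by simp
qed

lemma card_explored:
  assumes "finite V" "A \<subseteq> V" "a \<in> A" "B \<subseteq> V - A"
  shows "card (A - {a} \<union> B) = card A - 1 + card B"
proof -
  have "finite A" "finite B" using assms by (auto intro: finite_subset)
  then show ?thesis using assms by (subst card_Un_disjoint) auto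
qed

text \<open>The component of a vertex is what is reachable from it, so statements about the largest component
  become statements about the sets \<open>reach E {x}\<close>.\<close>

lemma components_eq_reach:
  assumes "E \<subseteq> vertex_pairs V"
  shows "components V E = (\<lambda>x. reach E {x}) ` V"
proof -
  have "{(x, y). x \<in> V \<and> y \<in> V \<and> (x, y) \<in> {(u, v). {u, v} \<in> E}\<^sup>*} `` {x} = reach E {x}"
    if "x \<in> V" for x
    using that reach_vertex_pairs[OF assms, of "{x}"] by (auto simp: reach_def)
  then show ?thesis by (auto simp: components_def quotient_def)
qed

lemma card_largest_component_less_iff:
  assumes V: "finite V" "V \<noteq> {}" and E: "E \<subseteq> vertex_pairs V"
  shows "card (largest_component V E) < M \<longleftrightarrow> (\<forall>x\<in>V. card (reach E {x}) < M)"
proof -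
  obtain x where x: "x \<in> V" using V by blast
  have "card C < Suc (card V)" if C: "C \<in> components V E" for C
  proof -
    obtain x where "x \<in> V" "C = reach E {x}"
      using C by (auto simp: components_eq_reach[OF E])
    then have "C \<subseteq> V"
      using reach_vertex_pairs[OF E, of "{x}"] by simp
    then show ?thesis using V by (simp add: less_Suc_eq_le card_mono)
  qed
  then have "largest_component V E \<in> components V E \<and>
      (\<forall>C. C \<in> components V E \<longrightarrow> card C \<le> card (largest_component V E))"
    unfolding largest_component_def using x
    by (intro arg_max_nat_lemma[of _ "reach E {x}" card "Suc (card V)"])
      (auto simp: components_eq_reach[OF E])
  then show ?thesis
    by (auto simp: components_eq_reach[OF E])
qed

section \<open>Subcritical graphs have small components\<close>

text \<open>The condition on \<open>g\<close> says that it is an upper solution of the fixed-point equation for the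
  generating function, at \<open>\<theta>\<close>, of the total progeny of a branching process with Poisson offspring
  of mean \<open>\<mu>\<close>. The component of \<open>A\<close> is stochastically dominated by the progeny of \<open>card A\<close> independent
  ancestors; the induction on the number of vertices expresses this comparison without a coupling.\<close>

lemma expectation_power_card_reach_le:
  fixes p :: "'v set \<Rightarrow> real"
  assumes V: "finite V" and A: "A \<subseteq> V"
    and p: "\<And>e. e \<in> vertex_pairs V \<Longrightarrow> 0 \<le> p e \<and> p e \<le> 1"
    and deg: "\<And>x. x \<in> V \<Longrightarrow> (\<Sum>y\<in>V - {x}. p {x, y}) \<le> \<mu>"
    and g: "1 \<le> g" and \<theta>: "0 \<le> \<theta>" "\<theta> * exp (\<mu> * (g - 1)) \<le> g"
  shows "measure_pmf.expectation (random_edges (vertex_pairs V) p) (\<lambda>E. \<theta> ^ card (reach E A))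
    \<le> g ^ card A"
  using V A p deg
proof (induction "card V" arbitrary: V A)
  case 0
  then have "A = {}" by simp
  then show ?case by (simp add: reach_def)
next
  case (Suc k)
  show ?case
  proof (cases "A = {}")
    case True
    then show ?thesis by (simp add: reach_def)
  next
    case False
    then obtain a where a: "a \<in> A" by blast
    let ?h = "\<lambda>B F. \<theta> * \<theta> ^ card (reach F (A - {a} \<union> B))"
    have "A \<noteq> {}" "finite A" using a Suc.prems by (auto intro: finite_subset)
    have p0: "0 \<le> p {x, y}" if "x \<in> V" "y \<in> V" "x \<noteq> y" for x y
      using Suc.prems(3)[of "{x, y}"] that by (auto simp: vertex_pairs_def)
    have deg': "(\<Sum>y\<in>V - {a} - {x}. p {x, y}) \<le> \<mu>" if "x \<in> V - {a}" for x
    proof -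
      have "(\<Sum>y\<in>V - {a} - {x}. p {x, y}) \<le> (\<Sum>y\<in>V - {x}. p {x, y})"
        using Suc.prems(1) that p0 by (intro sum_mono2) auto
      also have "\<dots> \<le> \<mu>" using that by (intro Suc.prems(4)) auto
      finally show ?thesis .
    qed
    have vp: "e \<in> vertex_pairs (V - {a}) \<Longrightarrow> e \<in> vertex_pairs V" for e
      by (auto simp: vertex_pairs_def)
    have "measure_pmf.expectation (random_edges (vertex_pairs V) p) (\<lambda>E. \<theta> ^ card (reach E A))
      \<le> (\<theta> * g ^ (card A - 1)) * (\<Prod>y\<in>V - A. 1 + p {a, y} * (g - 1))"
    proof (rule exploration_step[where h = ?h])
      fix E assume "E \<subseteq> vertex_pairs V"
      then show "\<theta> ^ card (reach E A) \<le> ?h (new_neighbours V A a E) {e \<in> E. a \<notin> e}"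
        using Suc.prems a by (subst card_reach_explore) auto
    next
      fix B assume B: "B \<subseteq> V - A"
      have "measure_pmf.expectation (random_edges (vertex_pairs (V - {a})) p)
          (\<lambda>F. \<theta> ^ card (reach F (A - {a} \<union> B))) \<le> g ^ card (A - {a} \<union> B)"
      proof (rule Suc.hyps(1))
        show "k = card (V - {a})" using Suc.hyps(2) Suc.prems(1,2) a by auto
        show "A - {a} \<union> B \<subseteq> V - {a}" using Suc.prems(2) a B by auto
        show "0 \<le> p e \<and> p e \<le> 1" if "e \<in> vertex_pairs (V - {a})" for e
          using Suc.prems(3) vp[OF that] .
      qed (use Suc.prems(1) deg' in auto)
      also have "\<dots> = g ^ (card A - 1) * g ^ card B"
        using Suc.prems a B by (subst card_explored) (auto simp: power_add)
      finally show "measure_pmf.expectation (random_edges (vertex_pairs (V - {a})) p) (?h B)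
          \<le> (\<theta> * g ^ (card A - 1)) * g ^ card B"
        using \<theta>(1) by (simp add: mult.assoc mult_left_mono)
    qed (use Suc.prems a g in auto)
    also have "\<dots> \<le> (\<theta> * g ^ (card A - 1)) * exp (\<mu> * (g - 1))"
    proof (rule mult_left_mono)
      have "(\<Prod>y\<in>V - A. 1 + p {a, y} * (g - 1)) \<le> exp ((g - 1) * (\<Sum>y\<in>V - A. p {a, y}))"
      proof (rule prod_one_plus_le_exp)
        fix y assume "y \<in> V - A"
        then have "0 \<le> p {a, y}" using a Suc.prems(2) by (intro p0) auto
        then show "0 \<le> 1 + p {a, y} * (g - 1)" using g by simp
      qed
      also have "\<dots> \<le> exp ((g - 1) * \<mu>)"
      proof -
        have "(\<Sum>y\<in>V - A. p {a, y}) \<le> (\<Sum>y\<in>V - {a}. p {a, y})"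
          using Suc.prems(1,2) a p0 by (intro sum_mono2) auto
        also have "\<dots> \<le> \<mu>" using Suc.prems(2) a by (intro Suc.prems(4)) auto
        finally show ?thesis using g by (simp add: mult_left_mono)
      qed
      finally show "(\<Prod>y\<in>V - A. 1 + p {a, y} * (g - 1)) \<le> exp (\<mu> * (g - 1))"
        by (simp add: mult.commute)
    qed (use g \<theta> in auto)
    also have "\<dots> = g ^ (card A - 1) * (\<theta> * exp (\<mu> * (g - 1)))" by simp
    also have "\<dots> \<le> g ^ (card A - 1) * g" using g \<theta> by (intro mult_left_mono) auto
    also have "\<dots> = g ^ card A"
      using \<open>A \<noteq> {}\<close> \<open>finite A\<close> by (metis card_gt_0_iff power_minus_mult)
    finally show ?thesis .
  qed
qed

text \<open>With expected degrees at most \<open>1 - \<eta>\<close>, the pair \<open>g = 1 + \<eta> / 2\<close> and \<open>\<theta> = exp (\<eta>\<^sup>2 / 4)\<close> satisfies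
  the condition of \<open>expectation_power_card_reach_le\<close>, because \<open>ln (1 + x) \<ge> x - x\<^sup>2\<close> for
  \<open>0 \<le> x \<le> 1\<close>. Markov's inequality gives an exponential tail for the component of each vertex.\<close>

lemma prob_large_component_le:
  fixes p :: "'v set \<Rightarrow> real"
  assumes V: "finite V" "V \<noteq> {}"
    and p: "\<And>e. e \<in> vertex_pairs V \<Longrightarrow> 0 \<le> p e \<and> p e \<le> 1"
    and deg: "\<And>x. x \<in> V \<Longrightarrow> (\<Sum>y\<in>V - {x}. p {x, y}) \<le> 1 - \<eta>"
    and \<eta>: "0 < \<eta>" "\<eta> < 1" and m: "0 \<le> m"
  shows "measure_pmf.prob (random_edges (vertex_pairs V) p) {E. real (card (largest_component V E)) > m}
    \<le> real (card V) * (2 * exp (- \<eta>\<^sup>2 / 4 * m))"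
proof -
  let ?P = "random_edges (vertex_pairs V) p"
  define g where "g = 1 + \<eta> / 2"
  define \<theta> where "\<theta> = exp (\<eta>\<^sup>2 / 4)"
  have "\<eta> / 2 - (\<eta> / 2)\<^sup>2 \<le> ln g"
    unfolding g_def using \<eta> by (intro ln_one_plus_pos_lower_bound) auto
  then have "\<eta>\<^sup>2 / 4 + (1 - \<eta>) * (g - 1) \<le> ln g"
    by (simp add: g_def field_simps power2_eq_square)
  then have "exp (\<eta>\<^sup>2 / 4 + (1 - \<eta>) * (g - 1)) \<le> exp (ln g)" by (subst exp_le_cancel_iff)
  then have \<theta>g: "\<theta> * exp ((1 - \<eta>) * (g - 1)) \<le> g"
    using \<eta> by (simp add: \<theta>_def exp_add g_def)
  have tail: "measure_pmf.prob ?P {E. real (card (reach E {x})) > m} \<le> 2 * exp (- \<eta>\<^sup>2 / 4 * m)"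
    if "x \<in> V" for x
  proof -
    have "measure_pmf.prob ?P {E. real (card (reach E {x})) > m} =
        measure_pmf.expectation ?P (indicator {E. real (card (reach E {x})) > m})"
      by simp
    also have "\<dots> \<le> measure_pmf.expectation ?P (\<lambda>E. exp (- \<eta>\<^sup>2 / 4 * m) * \<theta> ^ card (reach E {x}))"
    proof (intro integral_mono integrable_random_edges finite_vertex_pairs V)
      fix E :: "'v set set"
      let ?c = "card (reach E {x})"
      have "1 \<le> exp (- \<eta>\<^sup>2 / 4 * m) * \<theta> ^ ?c" if "real ?c > m"
      proof -
        have "1 \<le> exp (\<eta>\<^sup>2 / 4 * (real ?c - m))" using that by simp
        also have "\<dots> = exp (- \<eta>\<^sup>2 / 4 * m) * \<theta> ^ ?c"
          by (simp add: \<theta>_def exp_of_nat_mult[symmetric] exp_add[symmetric] field_simps)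
        finally show ?thesis .
      qed
      moreover have "0 \<le> exp (- \<eta>\<^sup>2 / 4 * m) * \<theta> ^ ?c" by (simp add: \<theta>_def)
      ultimately show "indicator {E. real (card (reach E {x})) > m} E \<le>
          exp (- \<eta>\<^sup>2 / 4 * m) * \<theta> ^ ?c"
        by (simp add: indicator_def)
    qed
    also have "\<dots> = exp (- \<eta>\<^sup>2 / 4 * m) * measure_pmf.expectation ?P (\<lambda>E. \<theta> ^ card (reach E {x}))"
      by simp
    also have "\<dots> \<le> exp (- \<eta>\<^sup>2 / 4 * m) * g ^ card {x}"
      using V that p deg \<eta> \<theta>g
      by (intro mult_left_mono expectation_power_card_reach_le) (auto simp: g_def \<theta>_def)
    also have "\<dots> \<le> exp (- \<eta>\<^sup>2 / 4 * m) * 2"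
      using \<eta> by (intro mult_left_mono) (auto simp: g_def)
    finally show ?thesis by simp
  qed
  have "measure_pmf.prob ?P {E. real (card (largest_component V E)) > m} \<le>
      measure_pmf.prob ?P (\<Union>x\<in>V. {E. real (card (reach E {x})) > m})"
  proof (intro measure_pmf.finite_measure_mono_AE AE_pmfI impI)
    fix E assume "E \<in> set_pmf ?P" "E \<in> {E. real (card (largest_component V E)) > m}"
    then have E: "E \<subseteq> vertex_pairs V" and big: "real (card (largest_component V E)) > m"
      using set_random_edges by auto
    then obtain x where "x \<in> V" "card (largest_component V E) \<le> card (reach E {x})"
      using card_largest_component_less_iff[OF V E, of "card (largest_component V E)"]
      by (meson less_irrefl not_less)
    then show "E \<in> (\<Union>x\<in>V. {E. real (card (reach E {x})) > m})"
      using big by fastforce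
  qed simp
  also have "\<dots> \<le> (\<Sum>x\<in>V. measure_pmf.prob ?P {E. real (card (reach E {x})) > m})"
    using V by (intro measure_pmf.finite_measure_subadditive_finite) auto
  also have "\<dots> \<le> (\<Sum>x\<in>V. 2 * exp (- \<eta>\<^sup>2 / 4 * m))"
    by (intro sum_mono tail)
  finally show ?thesis by simp
qed

section \<open>Supercritical graphs have a giant component\<close>

text \<open>The vertices connected to \<open>A\<close> are counted together, as if \<open>A\<close> were already connected: during the
  exploration the active vertices are joined through deleted ones.\<close>

definition small_components :: "nat \<Rightarrow> 'v set \<Rightarrow> 'v set \<Rightarrow> 'v set set \<Rightarrow> bool" where
  "small_components M V A E \<longleftrightarrow>
     card (reach E A) < M \<and> (\<forall>x\<in>V - reach E A. card (reach E {x}) < M)"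

lemma small_components_explore:
  assumes V: "finite V" and E: "E \<subseteq> vertex_pairs V" and A: "A \<subseteq> V" and a: "a \<in> A"
    and small: "small_components M V A E"
  shows "small_components M (V - {a}) (A - {a} \<union> new_neighbours V A a E) {e \<in> E. a \<notin> e}"
  unfolding small_components_def
proof (intro conjI ballI)
  let ?E = "{e \<in> E. a \<notin> e}" and ?A = "A - {a} \<union> new_neighbours V A a E"
  show "card (reach ?E ?A) < M"
    using small card_reach_explore[OF V E A a] by (simp add: small_components_def)
  fix x assume x: "x \<in> V - {a} - reach ?E ?A"
  then have "card (reach E {x}) < M"
    using small reach_explore(1)[OF E A a] by (auto simp: small_components_def)
  moreover have "finite (reach E {x})"
    using reach_vertex_pairs[OF E, of "{x}"] x V by (auto intro: finite_subset)
  then have "card (reach ?E {x}) \<le> card (reach E {x})"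
    by (intro card_mono reach_mono) auto
  ultimately show "card (reach ?E {x}) < M" by simp
qed

text \<open>The set \<open>V\<close> is what is left of \<open>V\<^sub>0\<close>, and \<open>t\<close> is the number of exploration steps still to be made.
  Each step multiplies \<open>z ^ card A\<close> in the mean by at most \<open>q\<close>, for the vertices discovered so far,
  \<open>V\<^sub>0 - V \<union> A\<close>, number at most \<open>r\<close> and leave every expected degree at least \<open>\<mu>\<close>. Once there are \<open>M\<close>
  active vertices the event is impossible, and before that \<open>z ^ card A / z ^ M \<ge> 1\<close>, so that the
  bound holds trivially with no steps left.\<close>

lemma prob_small_components_le:
  fixes p :: "'v set \<Rightarrow> real"
  assumes V\<^sub>0: "finite V\<^sub>0" and r: "r < card V\<^sub>0"
    and p: "\<And>e. e \<in> vertex_pairs V\<^sub>0 \<Longrightarrow> 0 \<le> p e \<and> p e \<le> 1"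
    and deg: "\<And>x R. x \<in> V\<^sub>0 \<Longrightarrow> R \<subseteq> V\<^sub>0 \<Longrightarrow> card R \<le> r \<Longrightarrow> \<mu> \<le> (\<Sum>y\<in>V\<^sub>0 - R - {x}. p {x, y})"
    and z: "0 < z" "z < 1" and q: "0 < q" "exp (- (1 - z) * \<mu>) \<le> q * z"
    and VA: "V \<subseteq> V\<^sub>0" "A \<subseteq> V" and t: "card (V\<^sub>0 - V) + t + M \<le> r"
  shows "measure_pmf.expectation (random_edges (vertex_pairs V) p)
      (\<lambda>E. of_bool (small_components M V A E)) \<le> q ^ t * z ^ card A / z ^ M"
  using VA t
proof (induction t arbitrary: V A)
  have triv: "measure_pmf.expectation (random_edges (vertex_pairs V) p)
      (\<lambda>E. of_bool (small_components M V A E)) \<le> q ^ t * z ^ card A / z ^ M"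
    if "V \<subseteq> V\<^sub>0" "A \<subseteq> V" "M \<le> card A" for V A t
  proof -
    have V: "finite V" using that V\<^sub>0 by (auto intro: finite_subset)
    have "measure_pmf.expectation (random_edges (vertex_pairs V) p)
        (\<lambda>E. of_bool (small_components M V A E) :: real) =
      measure_pmf.expectation (random_edges (vertex_pairs V) p) (\<lambda>E. 0)"
    proof (intro integral_cong_AE AE_pmfI)
      fix E assume "E \<in> set_pmf (random_edges (vertex_pairs V) p)"
      then have "E \<subseteq> vertex_pairs V" using set_random_edges by blast
      then have "finite (reach E A)"
        using reach_vertex_pairs that(2) V by (metis finite_subset)
      then have "card A \<le> card (reach E A)" by (intro card_mono subset_reach)
      then show "of_bool (small_components M V A E) = (0::real)"
        using that(3) by (auto simp: small_components_def)
    qed auto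
    then show ?thesis using z q by simp
  qed
  {
    case (0 V A)
    show ?case
    proof (cases "M \<le> card A")
      case True
      then show ?thesis using triv[of V A 0] 0 by simp
    next
      case False
      have "finite V" using 0 V\<^sub>0 by (auto intro: finite_subset)
      then have "measure_pmf.expectation (random_edges (vertex_pairs V) p)
        (\<lambda>E. of_bool (small_components M V A E) :: real) \<le>
        measure_pmf.expectation (random_edges (vertex_pairs V) p) (\<lambda>E. 1)"
        by (intro integral_mono integrable_random_edges finite_vertex_pairs) auto
      also have "\<dots> = 1" by simp
      also have "1 \<le> z ^ card A / z ^ M"
        using False z by (simp add: power_decreasing)
      finally show ?thesis by simp
    qed
  next
    case (Suc t V A)
    have V: "finite V" using Suc.prems V\<^sub>0 by (auto intro: finite_subset)
    have step: "measure_pmf.expectation (random_edges (vertex_pairs V) p)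
      (\<lambda>E. of_bool (small_components M V A E)) \<le> q ^ Suc t * z ^ card A / z ^ M"
      if A: "A \<subseteq> V" "card A < M" "a \<in> A" for A a
    proof -
      have vp: "e \<in> vertex_pairs V \<Longrightarrow> 0 \<le> p e \<and> p e \<le> 1" for e
        using p[of e] Suc.prems(1) by (auto simp: vertex_pairs_def)
      have p0: "0 \<le> p {x, y} \<and> p {x, y} \<le> 1" if "x \<in> V" "y \<in> V" "x \<noteq> y" for x y
        using vp[of "{x, y}"] that by (auto simp: vertex_pairs_def)
      have "finite A" using A V by (auto intro: finite_subset)
      have cA: "card A > 0" using A \<open>finite A\<close> by (auto simp: card_gt_0_iff)
      let ?h = "\<lambda>B F. of_bool (small_components M (V - {a}) (A - {a} \<union> B) F) :: real"
      let ?K = "q ^ t * z ^ (card A - 1) / z ^ M"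
      have "measure_pmf.expectation (random_edges (vertex_pairs V) p)
          (\<lambda>E. of_bool (small_components M V A E)) \<le> ?K * (\<Prod>y\<in>V - A. 1 + p {a, y} * (z - 1))"
      proof (rule exploration_step[where h = ?h])
        fix E assume "E \<subseteq> vertex_pairs V"
        then show "of_bool (small_components M V A E)
            \<le> ?h (new_neighbours V A a E) {e \<in> E. a \<notin> e}"
          using small_components_explore[OF V _ A(1,3), of E M] by simp
      next
        fix B assume B: "B \<subseteq> V - A"
        have "V\<^sub>0 - (V - {a}) = insert a (V\<^sub>0 - V)" using Suc.prems A by auto
        then have "card (V\<^sub>0 - (V - {a})) = Suc (card (V\<^sub>0 - V))"
          using A V\<^sub>0 by auto
        then have "measure_pmf.expectation (random_edges (vertex_pairs (V - {a})) p) (?h B)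
            \<le> q ^ t * z ^ card (A - {a} \<union> B) / z ^ M"
          using Suc.prems A B by (intro Suc.IH) auto
        also have "\<dots> = ?K * z ^ card B"
          using card_explored[OF V A(1,3) B] by (simp add: power_add)
        finally show "measure_pmf.expectation (random_edges (vertex_pairs (V - {a})) p) (?h B)
            \<le> ?K * z ^ card B" .
      qed (use V A vp z in auto)
      also have "\<dots> \<le> ?K * (q * z)"
      proof (rule mult_left_mono)
        have "(\<Prod>y\<in>V - A. 1 + p {a, y} * (z - 1)) \<le> exp ((z - 1) * (\<Sum>y\<in>V - A. p {a, y}))"
        proof (rule prod_one_plus_le_exp)
          fix y assume "y \<in> V - A"
          then have "p {a, y} * (1 - z) \<le> 1"
            using p0[of a y] A z by (intro mult_le_one) auto
          then show "0 \<le> 1 + p {a, y} * (z - 1)" by (simp add: algebra_simps)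
        qed
        also have "\<dots> \<le> exp (- (1 - z) * \<mu>)"
        proof -
          have "card (V\<^sub>0 - V \<union> A) \<le> card (V\<^sub>0 - V) + card A" by (rule card_Un_le)
          then have "\<mu> \<le> (\<Sum>y\<in>V\<^sub>0 - (V\<^sub>0 - V \<union> A) - {a}. p {a, y})"
            using Suc.prems A by (intro deg) auto
          also have "V\<^sub>0 - (V\<^sub>0 - V \<union> A) - {a} = V - A" using Suc.prems A by auto
          finally have "(1 - z) * \<mu> \<le> (1 - z) * (\<Sum>y\<in>V - A. p {a, y})"
            using z by (intro mult_left_mono) auto
          then show ?thesis by (simp add: algebra_simps)
        qed
        finally show "(\<Prod>y\<in>V - A. 1 + p {a, y} * (z - 1)) \<le> q * z" using q by linarith
      qed (use z q in auto)
      also have "\<dots> = q ^ Suc t * z ^ card A / z ^ M"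
        using cA by (cases "card A") auto
      finally show ?thesis .
    qed
    show ?case
    proof (cases "A = {}")
      case False
      then obtain a where "a \<in> A" by blast
      show ?thesis
      proof (cases "card A < M")
        case True
        then show ?thesis using step[OF Suc.prems(2) _ \<open>a \<in> A\<close>] by simp
      next
        case False
        then show ?thesis using Suc.prems by (intro triv) auto
      qed
    next
      case True
      \<comment> \<open>The active set ran empty, so any vertex may be activated; this only helps the bound since \<open>z \<le> 1\<close>.\<close>
      have "V \<noteq> {}" using Suc.prems r by auto
      then obtain a where a: "a \<in> V" by blast
      have "measure_pmf.expectation (random_edges (vertex_pairs V) p)
          (\<lambda>E. of_bool (small_components M V A E))
        \<le> measure_pmf.expectation (random_edges (vertex_pairs V) p)
          (\<lambda>E. of_bool (small_components M V {a} E) :: real)"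
        using V a True
        by (intro integral_mono integrable_random_edges finite_vertex_pairs)
          (auto simp: small_components_def reach_def)
      also have "\<dots> \<le> q ^ Suc t * z ^ card {a} / z ^ M"
      proof (cases "1 < M")
        case True
        then show ?thesis using a by (intro step) auto
      next
        case False
        then show ?thesis using a Suc.prems by (intro triv) auto
      qed
      also have "\<dots> \<le> q ^ Suc t * z ^ card A / z ^ M"
        using True z q by (intro divide_right_mono mult_left_mono) auto
      finally show ?thesis .
    qed
  }
qed

text \<open>The exploration of the whole graph from the empty active set; its first step already chooses an
  arbitrary starting vertex.\<close>

lemma prob_no_large_component_le:
  fixes p :: "'v set \<Rightarrow> real"
  assumes V: "finite V" and r: "r < card V"
    and p: "\<And>e. e \<in> vertex_pairs V \<Longrightarrow> 0 \<le> p e \<and> p e \<le> 1"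
    and deg: "\<And>x R. x \<in> V \<Longrightarrow> R \<subseteq> V \<Longrightarrow> card R \<le> r \<Longrightarrow> \<mu> \<le> (\<Sum>y\<in>V - R - {x}. p {x, y})"
    and z: "0 < z" "z < 1" and q: "0 < q" "exp (- (1 - z) * \<mu>) \<le> q * z"
    and t: "t + M \<le> r"
  shows "measure_pmf.prob (random_edges (vertex_pairs V) p) {E. card (largest_component V E) < M}
    \<le> q ^ t / z ^ M"
proof -
  let ?P = "random_edges (vertex_pairs V) p"
  have "V \<noteq> {}" using r by auto
  have "measure_pmf.prob ?P {E. card (largest_component V E) < M}
      \<le> measure_pmf.prob ?P {E. small_components M V {} E}"
  proof (intro measure_pmf.finite_measure_mono_AE AE_pmfI impI)
    fix E assume "E \<in> set_pmf ?P" "E \<in> {E. card (largest_component V E) < M}"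
    then have "E \<subseteq> vertex_pairs V" "card (largest_component V E) < M"
      using set_random_edges by auto
    then show "E \<in> {E. small_components M V {} E}"
      using card_largest_component_less_iff[OF V \<open>V \<noteq> {}\<close>, of E M]
      by (auto simp: small_components_def reach_def)
  qed simp
  also have "\<dots> = measure_pmf.expectation ?P (indicator {E. small_components M V {} E})"
    by simp
  also have "\<dots> = measure_pmf.expectation ?P (\<lambda>E. of_bool (small_components M V {} E))"
    by (intro Bochner_Integration.integral_cong) (auto simp: indicator_def)
  also have "\<dots> \<le> q ^ t * z ^ card ({} :: 'v set) / z ^ M"
    using V t by (intro prob_small_components_le[OF V r p deg z q]) auto
  finally show ?thesis by simp
qed

section \<open>Distances in the hierarchical ball\<close>

text \<open>For \<open>i \<ge> 1\<close>, the number of group elements of norm \<open>L ^ i\<close>, as a real number.\<close>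

definition sphere_card :: "nat \<Rightarrow> nat \<Rightarrow> nat \<Rightarrow> real" where
  "sphere_card d L i = (real L ^ d - 1) * real L ^ ((i - 1) * d)"

lemma hier_ball_subgroup:
  assumes L: "L \<ge> 2" and x: "x \<in> hier_ball d L n" and y: "y \<in> hier_ball d L n"
  shows "x \<otimes>\<^bsub>hier_group d L\<^esub> inv\<^bsub>hier_group d L\<^esub> y \<in> hier_ball d L n"
proof -
  interpret H: group "hier_group d L" by (rule group_hier_group)
  interpret T: group "torus_group d L" by (rule group_torus_group)
  have xy: "x \<in> carrier (hier_group d L)" "y \<in> carrier (hier_group d L)"
    using x y by (auto simp: hier_ball_def)
  have inv: "inv\<^bsub>hier_group d L\<^esub> y = (\<lambda>i\<in>{1..}. inv\<^bsub>torus_group d L\<^esub> y i)"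
    using xy unfolding hier_group_def by (intro inv_sum_group) (auto simp: group_torus_group)
  have "(x \<otimes>\<^bsub>hier_group d L\<^esub> inv\<^bsub>hier_group d L\<^esub> y) i = \<one>\<^bsub>torus_group d L\<^esub>" if "i > n" "i \<ge> 1" for i
  proof -
    have "x i = \<one>\<^bsub>torus_group d L\<^esub>" "y i = \<one>\<^bsub>torus_group d L\<^esub>"
      using x y xy that L by (auto simp: hier_ball_def hier_norm_le_iff)
    then show ?thesis
      using that unfolding inv by (simp add: hier_group_def)
  qed
  moreover have "x \<otimes>\<^bsub>hier_group d L\<^esub> inv\<^bsub>hier_group d L\<^esub> y \<in> carrier (hier_group d L)"
    using xy by simp
  ultimately show ?thesis
    using L by (simp add: hier_ball_def hier_norm_le_iff)
qed

lemma hier_norm_power: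
  assumes x: "x \<in> carrier (hier_group d L)" "x \<noteq> \<one>\<^bsub>hier_group d L\<^esub>"
  shows "\<exists>i\<ge>1. hier_norm d L x = real L ^ i"
proof -
  let ?S = "{i. i \<ge> 1 \<and> x i \<noteq> \<one>\<^bsub>torus_group d L\<^esub>}"
  have "finite ?S" using x by (simp add: carrier_hier_group)
  moreover have "?S \<noteq> {}"
  proof
    assume "?S = {}"
    then have "x = (\<lambda>i\<in>{1..}. \<one>\<^bsub>torus_group d L\<^esub>)"
      using x(1) by (auto simp: carrier_hier_group PiE_iff extensional_def fun_eq_iff)
    with x show False by (simp add: hier_group_def)
  qed
  ultimately have "Max ?S \<in> ?S" by (rule Max_in)
  then show ?thesis using x by (intro exI[of _ "Max ?S"]) (simp add: hier_norm_def)
qed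

lemma hier_ball_0:
  assumes "L \<ge> 2"
  shows "hier_ball d L 0 = {\<one>\<^bsub>hier_group d L\<^esub>}"
proof -
  have "\<one>\<^bsub>hier_group d L\<^esub> \<in> hier_ball d L 0"
    using group.is_monoid[OF group_hier_group] by (simp add: hier_ball_def hier_norm_def monoid.one_closed)
  moreover have "card (hier_ball d L 0) = 1" using card_hier_ball[OF assms, of d 0] by simp
  ultimately show ?thesis by (metis card_1_singletonE singletonD)
qed

lemma sum_hier_norm:
  fixes g :: "real \<Rightarrow> real"
  assumes L: "L \<ge> 2"
  shows "(\<Sum>x\<in>hier_ball d L n - {\<one>\<^bsub>hier_group d L\<^esub>}. g (hier_norm d L x)) =
    (\<Sum>i=1..n. sphere_card d L i * g (real L ^ i))"
proof (induction n)
  case 0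
  then show ?case using hier_ball_0[OF L] by simp
next
  case (Suc n)
  let ?B = "hier_ball d L" and ?e = "\<one>\<^bsub>hier_group d L\<^esub>"
  have "real L ^ n \<le> real L ^ Suc n" using L by (intro power_increasing) auto
  then have sub: "?B n \<subseteq> ?B (Suc n)" by (auto simp: hier_ball_def)
  have e: "?e \<in> ?B n"
    using group.is_monoid[OF group_hier_group]
    by (simp add: hier_ball_def hier_norm_def monoid.one_closed)
  have norm: "hier_norm d L x = real L ^ Suc n" if "x \<in> ?B (Suc n) - ?B n" for x
  proof -
    have x: "x \<in> carrier (hier_group d L)" "hier_norm d L x \<le> real L ^ Suc n" "hier_norm d L x > real L ^ n"
      using that by (auto simp: hier_ball_def)
    moreover have "x \<noteq> ?e" using that e by auto
    ultimately obtain i where i: "hier_norm d L x = real L ^ i" using hier_norm_power by blast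
    then have "i \<le> Suc n" "n < i" using x L by (auto simp del: power_Suc)
    then have "i = Suc n" by simp
    then show ?thesis using i by simp
  qed
  have "real (card (?B (Suc n) - ?B n)) = real (card (?B (Suc n))) - real (card (?B n))"
    using card_Diff_subset[OF card_hier_ball(2)[OF L] sub] card_mono[OF card_hier_ball(2)[OF L] sub]
    by (simp only: of_nat_diff)
  also have "\<dots> = sphere_card d L (Suc n)"
    by (simp add: card_hier_ball[OF L] sphere_card_def power_add algebra_simps)
  finally have card: "real (card (?B (Suc n) - ?B n)) = sphere_card d L (Suc n)" .
  have split: "?B (Suc n) - {?e} = (?B n - {?e}) \<union> (?B (Suc n) - ?B n)"
    using sub e by auto
  have "(\<Sum>x\<in>?B (Suc n) - {?e}. g (hier_norm d L x)) =
      (\<Sum>x\<in>?B n - {?e}. g (hier_norm d L x)) + (\<Sum>x\<in>?B (Suc n) - ?B n. g (hier_norm d L x))"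
    unfolding split using card_hier_ball(2)[OF L] by (intro sum.union_disjoint) auto
  also have "(\<Sum>x\<in>?B (Suc n) - ?B n. g (hier_norm d L x)) = (\<Sum>x\<in>?B (Suc n) - ?B n. g (real L ^ Suc n))"
    by (intro sum.cong refl) (simp only: norm)
  finally show ?case using Suc.IH card by (simp del: power_Suc)
qed

text \<open>Balls are subgroups, so the ball looks the same from each of its points.\<close>

lemma hier_diff_bij:
  assumes L: "L \<ge> 2" and x: "x \<in> hier_ball d L n"
  shows "bij_betw (\<lambda>y. x \<otimes>\<^bsub>hier_group d L\<^esub> inv\<^bsub>hier_group d L\<^esub> y)
    (hier_ball d L n - {x}) (hier_ball d L n - {\<one>\<^bsub>hier_group d L\<^esub>})"
proof -
  interpret H: group "hier_group d L" by (rule group_hier_group)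
  let ?f = "\<lambda>y. x \<otimes>\<^bsub>hier_group d L\<^esub> inv\<^bsub>hier_group d L\<^esub> y"
  have xc: "x \<in> carrier (hier_group d L)" using x by (simp add: hier_ball_def)
  have inj: "inj_on ?f (hier_ball d L n)"
    using xc by (auto simp: inj_on_def hier_ball_def intro: H.inv_inj[THEN inj_onD])
  have "?f ` hier_ball d L n \<subseteq> hier_ball d L n"
    using hier_ball_subgroup[OF L x] by auto
  then have "bij_betw ?f (hier_ball d L n) (hier_ball d L n)"
    using inj endo_inj_surj[OF card_hier_ball(2)[OF L] _ inj] by (simp add: bij_betw_def)
  then have "bij_betw ?f (hier_ball d L n - {x}) (hier_ball d L n - ?f ` {x})"
    using x hier_ball_subgroup[OF L x x] by (intro bij_betw_DiffI) auto
  then show ?thesis using xc by (simp add: H.r_inv)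
qed

lemma sum_hier_dist:
  fixes g :: "real \<Rightarrow> real"
  assumes L: "L \<ge> 2" and x: "x \<in> hier_ball d L n"
  shows "(\<Sum>y\<in>hier_ball d L n - {x}. g (hier_dist d L x y)) =
    (\<Sum>i=1..n. sphere_card d L i * g (real L ^ i))"
  unfolding hier_dist_def sum_hier_norm[OF L, symmetric]
  by (rule sum.reindex_bij_betw[OF hier_diff_bij[OF L x]])

lemma hier_dist_power:
  assumes L: "L \<ge> 2" and x: "x \<in> hier_ball d L n" and y: "y \<in> hier_ball d L n" "y \<noteq> x"
  obtains i where "1 \<le> i" "i \<le> n" "hier_dist d L x y = real L ^ i"
proof -
  have w: "x \<otimes>\<^bsub>hier_group d L\<^esub> inv\<^bsub>hier_group d L\<^esub> y \<in> hier_ball d L n - {\<one>\<^bsub>hier_group d L\<^esub>}"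
    using bij_betwE[OF hier_diff_bij[OF L x]] y by blast
  then obtain i where i: "i \<ge> 1" "hier_dist d L x y = real L ^ i"
    using hier_norm_power unfolding hier_ball_def hier_dist_def by blast
  moreover have "hier_dist d L x y \<le> real L ^ n"
    using w by (simp add: hier_ball_def hier_dist_def)
  ultimately show thesis using L that by auto
qed

lemma sum_sphere_card:
  "(\<Sum>i=1..n. sphere_card d L i) = real L ^ (n * d) - 1"
  by (induction n) (auto simp: sphere_card_def power_add algebra_simps)

lemma sphere_card_nonneg: "L \<ge> 2 \<Longrightarrow> 0 \<le> sphere_card d L i"
  by (simp add: sphere_card_def)

lemma sphere_card_le: "L \<ge> 2 \<Longrightarrow> 1 \<le> i \<Longrightarrow> sphere_card d L i \<le> (real L ^ d) ^ i"
proof -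
  assume "L \<ge> 2" "1 \<le> i"
  then have "sphere_card d L i \<le> real L ^ d * real L ^ ((i - 1) * d)"
    unfolding sphere_card_def by (intro mult_right_mono) auto
  also have "\<dots> = (real L ^ d) ^ i"
    using \<open>1 \<le> i\<close> by (cases i) (auto simp: power_add power_mult[symmetric] mult.commute)
  finally show ?thesis .
qed

section \<open>Expected degrees near criticality\<close>

definition crit_weight :: "nat \<Rightarrow> nat \<Rightarrow> (real \<Rightarrow> real) \<Rightarrow> nat \<Rightarrow> nat \<Rightarrow> real" where
  "crit_weight d L \<rho> n i = inverse (zeta d L \<rho> n) * \<rho> (real L ^ i)"

text \<open>The defining equation of \<open>zeta\<close>, subtracted from the count of all non-zero elements of the ball,
  says that the expected degree at criticality is one.\<close>

lemma crit_weight: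
  assumes L: "L \<ge> 2" and d: "d \<ge> 1" and n: "L ^ (n * d) > 2"
    and A: "0 < A\<^sub>1" and \<rho>: "admissible_rho \<alpha> A\<^sub>1 A\<^sub>2 \<rho>"
  shows "zeta d L \<rho> n > 0"
    and "(\<Sum>i=1..n. sphere_card d L i * (1 - exp (- crit_weight d L \<rho> n i))) = 1"
proof -
  note z = theI'[OF ex1_zeta[OF L d n A \<rho>], folded zeta_def]
  show "zeta d L \<rho> n > 0" using z by simp
  have "(\<Sum>i=1..n. sphere_card d L i * exp (- crit_weight d L \<rho> n i)) = real L ^ (n * d) - 2"
    using z by (simp add: sphere_card_def crit_weight_def sum_distrib_left mult.assoc)
  then show "(\<Sum>i=1..n. sphere_card d L i * (1 - exp (- crit_weight d L \<rho> n i))) = 1"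
    using sum_sphere_card[of d L n] by (simp add: right_diff_distrib sum_subtractf)
qed

lemma one_minus_exp_ge:
  fixes x :: real
  assumes "0 \<le> x"
  shows "x / (1 + x) \<le> 1 - exp (- x)"
proof -
  have "exp (- x) \<le> 1 / (1 + x)"
    using assms exp_ge_add_one_self[of x] by (simp add: exp_minus field_simps)
  then show ?thesis using assms by (simp add: field_simps)
qed

lemma admissible_rho_power:
  assumes L: "L \<ge> 2" and \<rho>: "admissible_rho \<alpha> A\<^sub>1 A\<^sub>2 \<rho>"
  shows "A\<^sub>1 * (real L powr (-\<alpha>)) ^ i \<le> \<rho> (real L ^ i)" "\<rho> (real L ^ i) \<le> A\<^sub>2 * (real L powr (-\<alpha>)) ^ i"
proof -
  have "(real L ^ i) powr (-\<alpha>) = (real L powr (-\<alpha>)) ^ i"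
    using L by (simp add: powr_realpow[symmetric] powr_powr mult.commute)
  moreover have "real L ^ i \<ge> 1" using L by (intro one_le_power) auto
  ultimately show "A\<^sub>1 * (real L powr (-\<alpha>)) ^ i \<le> \<rho> (real L ^ i)" "\<rho> (real L ^ i) \<le> A\<^sub>2 * (real L powr (-\<alpha>)) ^ i"
    using \<rho> unfolding admissible_rho_def by metis+
qed

text \<open>At least half of the ball lies on the outermost sphere, so total degree one forces the weight
  there to be at most \<open>4 / N\<close>. As \<open>\<rho>\<close> at that distance is at least \<open>A\<^sub>1 * a ^ n\<close>, this
  bounds \<open>1 / zeta\<close>, and with it the weights at all distances.\<close>

lemma crit_weight_bounds:
  fixes d L :: nat and \<alpha> :: real
  defines "a \<equiv> real L powr (-\<alpha>)"
  assumes L: "L \<ge> 2" and d: "d \<ge> 1" and n: "L ^ (n * d) \<ge> 4"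
    and A: "0 < A\<^sub>1" and \<rho>: "admissible_rho \<alpha> A\<^sub>1 A\<^sub>2 \<rho>"
  shows "0 \<le> crit_weight d L \<rho> n i"
    and "crit_weight d L \<rho> n i \<le> 4 * A\<^sub>2 / A\<^sub>1 * a ^ i / (real L ^ d * a) ^ n"
proof -
  let ?s = "inverse (zeta d L \<rho> n)" and ?k = "crit_weight d L \<rho> n" and ?N = "real L ^ (n * d)"
  have n2: "L ^ (n * d) > 2" using n by simp
  have s: "?s > 0" using crit_weight(1)[OF L d n2 A \<rho>] by simp
  have a: "a > 0" using L by (simp add: a_def)
  have N: "?N \<ge> 4" using n by (metis of_nat_le_iff of_nat_numeral of_nat_power)
  have rho0: "0 \<le> \<rho> (real L ^ i)" for i
    using \<rho> by (simp add: admissible_rho_def)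
  show k0: "0 \<le> ?k i" for i
    using s rho0[of i] by (simp add: crit_weight_def)
  have "n \<noteq> 0" using n by (cases n) auto
  have "2 * 1 \<le> real L * real L ^ (d - 1)"
    using L by (intro mult_mono) auto
  then have Ld: "real L ^ d \<ge> 2" using d by (cases d) auto
  have "?N = real L ^ d * real L ^ ((n - 1) * d)"
    using \<open>n \<noteq> 0\<close> by (cases n) (auto simp: power_add)
  moreover have "real L ^ d / 2 * real L ^ ((n - 1) * d) \<le> sphere_card d L n"
    unfolding sphere_card_def using Ld by (intro mult_right_mono) auto
  ultimately have m: "?N / 2 \<le> sphere_card d L n" by simp
  have "sphere_card d L n * (1 - exp (- ?k n)) \<le> (\<Sum>i=1..n. sphere_card d L i * (1 - exp (- ?k i)))"
    using \<open>n \<noteq> 0\<close> k0 L by (intro member_le_sum mult_nonneg_nonneg sphere_card_nonneg) auto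
  also have "\<dots> = 1" by (rule crit_weight(2)[OF L d n2 A \<rho>])
  finally have "sphere_card d L n * (?k n / (1 + ?k n)) \<le> 1"
    using mult_left_mono[OF one_minus_exp_ge[OF k0, of n] sphere_card_nonneg[OF L, of d n]] by linarith
  moreover have "?N / 2 * (?k n / (1 + ?k n)) \<le> sphere_card d L n * (?k n / (1 + ?k n))"
    using k0[of n] by (intro mult_right_mono m) auto
  ultimately have "?N / 2 * (?k n / (1 + ?k n)) \<le> 1" by linarith
  then have "?N * ?k n \<le> 2 + 2 * ?k n" using k0[of n] by (simp add: field_simps)
  moreover have "2 * ?k n \<le> ?N / 2 * ?k n" using N k0[of n] by (intro mult_right_mono) auto
  ultimately have kn: "?N * ?k n \<le> 4" by simp
  have "?N * (?s * (A\<^sub>1 * a ^ n)) \<le> ?N * ?k n"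
    unfolding crit_weight_def a_def using s admissible_rho_power(1)[OF L \<rho>, of n]
    by (intro mult_left_mono) auto
  then have "?s * (A\<^sub>1 * (real L ^ d * a) ^ n) \<le> 4"
    using kn by (simp add: power_mult_distrib power_mult[symmetric] mult_ac)
  moreover have "(real L ^ d * a) ^ n > 0" using L a by simp
  ultimately have s_le: "?s \<le> 4 / (A\<^sub>1 * (real L ^ d * a) ^ n)"
    using A by (simp add: pos_le_divide_eq)
  have "?k i \<le> ?s * (A\<^sub>2 * a ^ i)"
    unfolding crit_weight_def a_def using s admissible_rho_power(2)[OF L \<rho>, of i]
    by (intro mult_left_mono) auto
  also have "\<dots> \<le> 4 / (A\<^sub>1 * (real L ^ d * a) ^ n) * (A\<^sub>2 * a ^ i)"
    using rho0[of i] admissible_rho_power(2)[OF L \<rho>, of i] unfolding a_def[symmetric]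
    by (intro mult_right_mono s_le) auto
  finally show "?k i \<le> 4 * A\<^sub>2 / A\<^sub>1 * a ^ i / (real L ^ d * a) ^ n"
    by (simp add: field_simps)
qed

lemma edge_prob_near_critical:
  assumes x: "x \<in> hier_ball d L n" and y: "y \<in> hier_ball d L n" "x \<noteq> y"
  shows "edge_prob (near_critical_kernel d L \<rho> t n) {x, y} =
    1 - exp (- ((1 + t) * inverse (zeta d L \<rho> n) * \<rho> (hier_dist d L x y)))"
proof -
  have "near_critical_kernel d L \<rho> t n u v = near_critical_kernel d L \<rho> t n v u"
    if "u \<in> {x, y}" "v \<in> {x, y}" for u v
  proof -
    have "u \<in> carrier (hier_group d L)" "v \<in> carrier (hier_group d L)"
      using that x y by (auto simp: hier_ball_def)
    then show ?thesis
      by (simp add: near_critical_kernel_def hier_kernel_def hier_dist_commute)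
  qed
  then show ?thesis
    using edge_prob_doubleton[of x y "near_critical_kernel d L \<rho> t n"] y(2)
    by (simp add: near_critical_kernel_def hier_kernel_def)
qed

lemma sum_edge_prob_near_critical:
  assumes L: "L \<ge> 2" and x: "x \<in> hier_ball d L n"
  shows "(\<Sum>y\<in>hier_ball d L n - {x}. edge_prob (near_critical_kernel d L \<rho> t n) {x, y}) =
    (\<Sum>i=1..n. sphere_card d L i * (1 - exp (- ((1 + t) * crit_weight d L \<rho> n i))))"
proof -
  have "(\<Sum>y\<in>hier_ball d L n - {x}. edge_prob (near_critical_kernel d L \<rho> t n) {x, y}) =
     (\<Sum>y\<in>hier_ball d L n - {x}.
        1 - exp (- ((1 + t) * inverse (zeta d L \<rho> n) * \<rho> (hier_dist d L x y))))"
    using x by (intro sum.cong refl edge_prob_near_critical) auto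
  also have "\<dots> = (\<Sum>i=1..n. sphere_card d L i * (1 - exp (- ((1 + t) * crit_weight d L \<rho> n i))))"
    using sum_hier_dist[OF L x, of "\<lambda>r. 1 - exp (- ((1 + t) * inverse (zeta d L \<rho> n) * \<rho> r))"]
    by (simp only: crit_weight_def mult.assoc)
  finally show ?thesis .
qed

lemma edge_prob_near_critical_bounds:
  assumes L: "L \<ge> 2" and d: "d \<ge> 1" and n: "L ^ (n * d) > 2"
    and A: "0 < A\<^sub>1" and \<rho>: "admissible_rho \<alpha> A\<^sub>1 A\<^sub>2 \<rho>" and t: "0 \<le> 1 + t"
    and e: "e \<in> vertex_pairs (hier_ball d L n)"
  shows "0 \<le> edge_prob (near_critical_kernel d L \<rho> t n) e \<and>
    edge_prob (near_critical_kernel d L \<rho> t n) e \<le> 1"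
proof -
  obtain x y where xy: "e = {x, y}" "x \<in> hier_ball d L n" "y \<in> hier_ball d L n" "x \<noteq> y"
    using e by (auto simp: vertex_pairs_def)
  have "0 \<le> hier_dist d L x y" by (simp add: hier_dist_def hier_norm_def)
  then have "0 \<le> \<rho> (hier_dist d L x y)" using \<rho> by (simp add: admissible_rho_def)
  then have "0 \<le> (1 + t) * inverse (zeta d L \<rho> n) * \<rho> (hier_dist d L x y)"
    using t crit_weight(1)[OF L d n A \<rho>] by simp
  then show ?thesis unfolding xy(1) edge_prob_near_critical[OF xy(2-4)] by simp
qed

lemma filterlim_realpow_at_top:
  fixes x :: real
  assumes "1 < x"
  shows "filterlim (\<lambda>n. x ^ n) at_top sequentially"
  using assms
  by (intro filterlim_at_infinity_imp_filterlim_at_top filterlim_realpow_sequentially_gt1) auto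

lemma eventually_hier_ball_large:
  fixes K :: real
  assumes L: "L \<ge> 2" and d: "d \<ge> 1"
  shows "\<forall>\<^sub>F n in sequentially. K \<le> real L ^ (n * d)"
proof -
  have "real L ^ d > 1" using L d by (intro one_less_power) auto
  then have "filterlim (\<lambda>n. (real L ^ d) ^ n) at_top sequentially"
    by (rule filterlim_realpow_at_top)
  then show ?thesis
    by (simp add: filterlim_at_top power_mult[symmetric] mult.commute[of d])
qed

lemma powr_params:
  assumes L: "L \<ge> 2" and \<alpha>: "0 < \<alpha>" "\<alpha> < real d"
  shows "0 < real L powr (-\<alpha>)" "real L powr (-\<alpha>) < 1" "1 < real L ^ d * real L powr (-\<alpha>)"
proof -
  show "0 < real L powr (-\<alpha>)" using L by simp
  show "real L powr (-\<alpha>) < 1"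
    using L \<alpha> by (simp add: powr_less_one)
  have "real L ^ d * real L powr (-\<alpha>) = real L powr (real d - \<alpha>)"
    using L by (simp add: powr_realpow[symmetric] powr_add[symmetric])
  also have "\<dots> > 1" using L \<alpha> by simp
  finally show "1 < real L ^ d * real L powr (-\<alpha>)" .
qed

text \<open>By \<open>powr_params\<close> the denominator in \<open>crit_weight_bounds\<close> is a power of a number greater than one;
  this is where \<open>\<alpha> < d\<close> enters.\<close>

lemma crit_weight_uniformly_small:
  fixes \<delta> :: real
  assumes L: "L \<ge> 2" and d: "d \<ge> 1" and \<alpha>: "0 < \<alpha>" "\<alpha> < real d"
    and A: "0 < A\<^sub>1" "A\<^sub>1 \<le> A\<^sub>2" and \<rho>: "admissible_rho \<alpha> A\<^sub>1 A\<^sub>2 \<rho>" and \<delta>: "\<delta> > 0"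
  shows "\<forall>\<^sub>F n in sequentially. \<forall>i. crit_weight d L \<rho> n i \<le> \<delta>"
proof -
  define a where "a = real L powr (-\<alpha>)"
  note a = powr_params[OF L \<alpha>, folded a_def]
  have "filterlim (\<lambda>n. (real L ^ d * a) ^ n) at_top sequentially"
    using a(3) by (rule filterlim_realpow_at_top)
  then have "\<forall>\<^sub>F n in sequentially. 4 * A\<^sub>2 / A\<^sub>1 / \<delta> \<le> (real L ^ d * a) ^ n"
    by (simp add: filterlim_at_top)
  with eventually_hier_ball_large[OF L d, of 4] show ?thesis
  proof eventually_elim
    case (elim n)
    then have n4: "L ^ (n * d) \<ge> 4"
      by (metis of_nat_le_iff of_nat_numeral of_nat_power)
    show ?case
    proof
      fix i
      have "crit_weight d L \<rho> n i \<le> 4 * A\<^sub>2 / A\<^sub>1 * a ^ i / (real L ^ d * a) ^ n"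
        unfolding a_def by (rule crit_weight_bounds(2)[OF L d n4 A(1) \<rho>])
      also have "\<dots> \<le> 4 * A\<^sub>2 / A\<^sub>1 * 1 / (real L ^ d * a) ^ n"
        using a A by (intro divide_right_mono mult_left_mono power_le_one) auto
      also have "\<dots> \<le> \<delta>"
      proof -
        have "4 * A\<^sub>2 / A\<^sub>1 \<le> (real L ^ d * a) ^ n * \<delta>"
          using elim(2) \<delta> by (simp only: pos_divide_le_eq)
        moreover have "(real L ^ d * a) ^ n > 0" using a(3) by (intro zero_less_power) linarith
        ultimately show ?thesis by (simp only: pos_divide_le_eq mult_1_right mult.commute[of \<delta>])
      qed
      finally show "crit_weight d L \<rho> n i \<le> \<delta>" .
    qed
  qed
qed

text \<open>The upper bound \<open>1 - exp (- (1 - \<epsilon>) k) \<le> (1 - \<epsilon>) k\<close> and, for \<open>k \<le> \<epsilon> / 2\<close>, the lower bound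
  \<open>1 - exp (- k) \<ge> k / (1 + \<epsilon> / 2)\<close> compare the degree termwise with the critical one, which is one.
  The factor obtained, \<open>(1 - \<epsilon>) (1 + \<epsilon> / 2)\<close>, is below \<open>1 - \<epsilon> / 2\<close>.\<close>

lemma subcritical_degree:
  assumes L: "L \<ge> 2" and d: "d \<ge> 1" and \<alpha>: "0 < \<alpha>" "\<alpha> < real d"
    and A: "0 < A\<^sub>1" "A\<^sub>1 \<le> A\<^sub>2" and \<rho>: "admissible_rho \<alpha> A\<^sub>1 A\<^sub>2 \<rho>" and \<epsilon>: "0 < \<epsilon>" "\<epsilon> < 1"
  shows "\<forall>\<^sub>F n in sequentially.
    (\<Sum>i=1..n. sphere_card d L i * (1 - exp (- ((1 - \<epsilon>) * crit_weight d L \<rho> n i)))) \<le> 1 - \<epsilon> / 2"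
proof -
  have "\<epsilon> / 2 > 0" using \<epsilon> by simp
  from eventually_hier_ball_large[OF L d, of 4] crit_weight_uniformly_small[OF L d \<alpha> A \<rho> this]
  show ?thesis
  proof eventually_elim
    case (elim n)
    let ?k = "crit_weight d L \<rho> n" and ?m = "sphere_card d L"
    have n4: "L ^ (n * d) \<ge> 4"
      using elim(1) by (metis of_nat_le_iff of_nat_numeral of_nat_power)
    have k0: "0 \<le> ?k i" for i by (rule crit_weight_bounds(1)[OF L d n4 A(1) \<rho>])
    have ki: "?k i \<le> \<epsilon> / 2" for i using elim(2) \<epsilon> by simp
    have k: "1 - exp (- ((1 - \<epsilon>) * ?k i)) \<le> (1 - \<epsilon>) * (1 + \<epsilon> / 2) * (1 - exp (- ?k i))" for i
    proof -
      have "?k i / (1 + \<epsilon> / 2) \<le> ?k i / (1 + ?k i)"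
        using k0[of i] ki[of i] by (intro divide_left_mono) auto
      also have "\<dots> \<le> 1 - exp (- ?k i)" by (rule one_minus_exp_ge[OF k0])
      finally have "?k i \<le> (1 + \<epsilon> / 2) * (1 - exp (- ?k i))"
        using \<epsilon> by (simp add: pos_divide_le_eq mult.commute)
      then have "(1 - \<epsilon>) * ?k i \<le> (1 - \<epsilon>) * ((1 + \<epsilon> / 2) * (1 - exp (- ?k i)))"
        using \<epsilon> by (intro mult_left_mono) auto
      moreover have "1 - exp (- ((1 - \<epsilon>) * ?k i)) \<le> (1 - \<epsilon>) * ?k i"
        using exp_ge_add_one_self[of "- ((1 - \<epsilon>) * ?k i)"] by linarith
      ultimately show ?thesis by (simp add: mult.assoc)
    qed
    have "(\<Sum>i=1..n. ?m i * (1 - exp (- ((1 - \<epsilon>) * ?k i)))) \<le>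
        (\<Sum>i=1..n. ?m i * ((1 - \<epsilon>) * (1 + \<epsilon> / 2) * (1 - exp (- ?k i))))"
      by (intro sum_mono mult_left_mono k sphere_card_nonneg L)
    also have "\<dots> = (1 - \<epsilon>) * (1 + \<epsilon> / 2) * (\<Sum>i=1..n. ?m i * (1 - exp (- ?k i)))"
      by (simp add: sum_distrib_left mult_ac)
    also have "\<dots> = (1 - \<epsilon>) * (1 + \<epsilon> / 2)"
      using n4 by (subst crit_weight(2)[OF L d _ A(1) \<rho>]) auto
    also have "\<dots> \<le> 1 - \<epsilon> / 2" using \<epsilon> by (simp add: field_simps)
    finally show ?case .
  qed
qed

lemma supercritical_degree:
  assumes L: "L \<ge> 2" and d: "d \<ge> 1" and \<alpha>: "0 < \<alpha>" "\<alpha> < real d"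
    and A: "0 < A\<^sub>1" "A\<^sub>1 \<le> A\<^sub>2" and \<rho>: "admissible_rho \<alpha> A\<^sub>1 A\<^sub>2 \<rho>" and \<epsilon>: "0 < \<epsilon>"
  shows "\<forall>\<^sub>F n in sequentially.
    1 + \<epsilon> / 2 \<le> (\<Sum>i=1..n. sphere_card d L i * (1 - exp (- ((1 + \<epsilon>) * crit_weight d L \<rho> n i))))"
proof -
  \<comment> \<open>The bound on the weights for which \<open>(1 + \<epsilon>) / (1 + (1 + \<epsilon>) * \<delta>) = 1 + \<epsilon> / 2\<close>.\<close>
  define \<delta> where "\<delta> = \<epsilon> / 2 / (1 + \<epsilon> / 2) / (1 + \<epsilon>)"
  have \<delta>: "\<delta> > 0" using \<epsilon> by (simp add: \<delta>_def)
  from eventually_hier_ball_large[OF L d, of 4] crit_weight_uniformly_small[OF L d \<alpha> A \<rho> \<delta>]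
  show ?thesis
  proof eventually_elim
    case (elim n)
    let ?k = "crit_weight d L \<rho> n" and ?m = "sphere_card d L"
    have n4: "L ^ (n * d) \<ge> 4"
      using elim(1) by (metis of_nat_le_iff of_nat_numeral of_nat_power)
    have k0: "0 \<le> ?k i" for i by (rule crit_weight_bounds(1)[OF L d n4 A(1) \<rho>])
    have k: "(1 + \<epsilon> / 2) * (1 - exp (- ?k i)) \<le> 1 - exp (- ((1 + \<epsilon>) * ?k i))" for i
    proof -
      have "(1 + \<epsilon>) * ?k i \<le> (1 + \<epsilon>) * \<delta>"
        using elim(2) \<epsilon> by (intro mult_left_mono) auto
      also have "\<dots> = \<epsilon> / 2 / (1 + \<epsilon> / 2)" using \<epsilon> by (simp add: \<delta>_def)
      finally have "(1 + (1 + \<epsilon>) * ?k i) * (1 + \<epsilon> / 2) \<le> (1 + \<epsilon> / 2 / (1 + \<epsilon> / 2)) * (1 + \<epsilon> / 2)"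
        using \<epsilon> by (intro mult_right_mono) auto
      also have "\<dots> = 1 + \<epsilon>" using \<epsilon> by (simp add: field_simps)
      finally have "(1 + (1 + \<epsilon>) * ?k i) * (1 + \<epsilon> / 2) * ?k i \<le> (1 + \<epsilon>) * ?k i"
        by (rule mult_right_mono[OF _ k0])
      then have "(1 + \<epsilon> / 2) * ?k i * (1 + (1 + \<epsilon>) * ?k i) \<le> (1 + \<epsilon>) * ?k i"
        by (simp only: mult_ac)
      then have "(1 + \<epsilon> / 2) * ?k i \<le> (1 + \<epsilon>) * ?k i / (1 + (1 + \<epsilon>) * ?k i)"
        using k0[of i] \<epsilon> by (subst pos_le_divide_eq) (auto intro: add_pos_nonneg)
      also have "\<dots> \<le> 1 - exp (- ((1 + \<epsilon>) * ?k i))"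
        using k0 \<epsilon> by (intro one_minus_exp_ge) auto
      finally have "(1 + \<epsilon> / 2) * ?k i \<le> 1 - exp (- ((1 + \<epsilon>) * ?k i))" .
      moreover have "(1 + \<epsilon> / 2) * (1 - exp (- ?k i)) \<le> (1 + \<epsilon> / 2) * ?k i"
        using exp_ge_add_one_self[of "- ?k i"] \<epsilon> by (intro mult_left_mono) auto
      ultimately show ?thesis by linarith
    qed
    have "1 + \<epsilon> / 2 = (1 + \<epsilon> / 2) * (\<Sum>i=1..n. ?m i * (1 - exp (- ?k i)))"
      using n4 by (subst crit_weight(2)[OF L d _ A(1) \<rho>]) auto
    also have "\<dots> = (\<Sum>i=1..n. ?m i * ((1 + \<epsilon> / 2) * (1 - exp (- ?k i))))"
      by (simp add: sum_distrib_left mult_ac)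
    also have "\<dots> \<le> (\<Sum>i=1..n. ?m i * (1 - exp (- ((1 + \<epsilon>) * ?k i))))"
      by (intro sum_mono mult_left_mono k sphere_card_nonneg L)
    finally show ?case .
  qed
qed

text \<open>With \<open>c = L ^ d * L powr (- \<alpha>) > 1\<close>, the vertices at distance \<open>L ^ i\<close> contribute to a degree at
  most a constant times \<open>c ^ i / c ^ n\<close>. Hence for a large constant \<open>k\<close> the vertices within distance
  \<open>L ^ (n - k)\<close> contribute at most \<open>\<eta> / 2\<close> altogether. Farther away each edge probability is at most
  a constant, depending on \<open>k\<close>, divided by \<open>N\<close>; so \<open>\<theta> * N\<close> such vertices contribute at most \<open>\<eta> / 2\<close>
  if \<open>\<theta>\<close> is small. Neither \<open>k\<close> nor \<open>\<theta>\<close> depends on \<open>\<rho>\<close>.\<close>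

lemma degree_loss_le:
  assumes L: "L \<ge> 2" and d: "d \<ge> 1" and \<alpha>: "0 < \<alpha>" "\<alpha> < real d"
    and A: "0 < A\<^sub>1" "A\<^sub>1 \<le> A\<^sub>2" and \<eta>: "0 < \<eta>" and \<epsilon>: "0 < \<epsilon>"
  obtains \<theta> where "0 < \<theta>" "\<theta> < 1"
    "\<And>\<rho>. admissible_rho \<alpha> A\<^sub>1 A\<^sub>2 \<rho> \<Longrightarrow> \<forall>\<^sub>F n in sequentially. \<forall>x\<in>hier_ball d L n. \<forall>R\<subseteq>hier_ball d L n.
      real (card R) \<le> \<theta> * real L ^ (n * d) \<longrightarrow>
      (\<Sum>y\<in>R - {x}. edge_prob (near_critical_kernel d L \<rho> \<epsilon> n) {x, y}) \<le> \<eta>"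
proof -
  define a where "a = real L powr (-\<alpha>)"
  define c where "c = real L ^ d * a"
  define B where "B = (1 + \<epsilon>) * (4 * A\<^sub>2 / A\<^sub>1)"
  note a = powr_params[OF L \<alpha>, folded a_def, folded c_def]
  have B: "B > 0" using A \<epsilon> by (simp add: B_def)
  have "\<forall>\<^sub>F k in sequentially. B * c / (c - 1) / (\<eta> / 2) \<le> c ^ k"
    using filterlim_realpow_at_top[OF a(3)] by (simp add: filterlim_at_top)
  then obtain k where k: "B * c / (c - 1) / (\<eta> / 2) \<le> c ^ k"
    by (auto simp: eventually_sequentially)
  define \<theta> where "\<theta> = min (1 / 2) (\<eta> / 2 * a ^ k / B)"
  show thesis
  proof (rule that)
    show "0 < \<theta>" using \<eta> a B by (simp add: \<theta>_def)
    show "\<theta> < 1" by (simp add: \<theta>_def)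
    fix \<rho> assume \<rho>: "admissible_rho \<alpha> A\<^sub>1 A\<^sub>2 \<rho>"
    from eventually_hier_ball_large[OF L d, of 4] eventually_ge_at_top[of k]
    show "\<forall>\<^sub>F n in sequentially. \<forall>x\<in>hier_ball d L n. \<forall>R\<subseteq>hier_ball d L n.
      real (card R) \<le> \<theta> * real L ^ (n * d) \<longrightarrow>
      (\<Sum>y\<in>R - {x}. edge_prob (near_critical_kernel d L \<rho> \<epsilon> n) {x, y}) \<le> \<eta>"
    proof eventually_elim
      case (elim n)
      let ?N = "real L ^ (n * d)" and ?\<Lambda> = "hier_ball d L n"
      have n4: "L ^ (n * d) \<ge> 4"
        using elim(1) by (metis of_nat_le_iff of_nat_numeral of_nat_power)
      have cn: "c ^ n = ?N * a ^ n"
        by (simp add: c_def power_mult_distrib power_mult[symmetric] mult.commute[of d])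
      have cn0: "0 < c ^ n" using a(3) by simp
      define f where "f i = B * a ^ i / c ^ n" for i
      have f0: "0 \<le> f i" for i using a B cn0 by (simp add: f_def)
      have conn: "1 - exp (- ((1 + \<epsilon>) * crit_weight d L \<rho> n i)) \<le> f i" for i
      proof -
        have "1 - exp (- ((1 + \<epsilon>) * crit_weight d L \<rho> n i)) \<le> (1 + \<epsilon>) * crit_weight d L \<rho> n i"
          using exp_ge_add_one_self[of "- ((1 + \<epsilon>) * crit_weight d L \<rho> n i)"] by linarith
        also have "\<dots> \<le> (1 + \<epsilon>) * (4 * A\<^sub>2 / A\<^sub>1 * a ^ i / c ^ n)"
          unfolding c_def a_def using \<epsilon>
          by (intro mult_left_mono crit_weight_bounds(2)[OF L d n4 A(1) \<rho>]) auto
        finally show ?thesis by (simp add: f_def B_def)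
      qed
      have near: "(\<Sum>i=1..n - k. sphere_card d L i * f i) \<le> \<eta> / 2"
      proof -
        have "(\<Sum>i=1..n - k. sphere_card d L i * f i) \<le> (\<Sum>i=1..n - k. (real L ^ d) ^ i * f i)"
          by (intro sum_mono mult_right_mono sphere_card_le L f0) auto
        also have "\<dots> = B / c ^ n * (\<Sum>i=1..n - k. c ^ i)"
          by (simp add: f_def c_def sum_distrib_left power_mult_distrib mult_ac)
        also have "\<dots> \<le> B / c ^ n * (\<Sum>i<Suc (n - k). c ^ i)"
          using B cn0 a by (intro mult_left_mono sum_mono2) auto
        also have "(\<Sum>i<Suc (n - k). c ^ i) = (c ^ Suc (n - k) - 1) / (c - 1)"
          using a by (intro geometric_sum) auto
        also have "B / c ^ n * ((c ^ Suc (n - k) - 1) / (c - 1)) \<le> B / c ^ n * (c ^ Suc (n - k) / (c - 1))"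
          using a B cn0 by (intro mult_left_mono divide_right_mono) auto
        also have "\<dots> = B * c / (c - 1) / c ^ k"
          using elim(2) a by (simp add: power_diff field_simps)
        also have "\<dots> \<le> \<eta> / 2"
          using k \<eta> a by (simp add: field_simps)
        finally show ?thesis .
      qed
      show ?case
      proof (intro ballI allI impI)
        fix x R assume x: "x \<in> ?\<Lambda>" and R: "R \<subseteq> ?\<Lambda>" and card: "real (card R) \<le> \<theta> * ?N"
        let ?p = "\<lambda>y. edge_prob (near_critical_kernel d L \<rho> \<epsilon> n) {x, y}"
        define F where "F = B * a ^ (n - k) / c ^ n"
        \<comment> \<open>The edge probability at distance \<open>r\<close>, cut off beyond the near part of the ball.\<close>
        define h where "h r = (if r \<le> real L ^ (n - k) then
            1 - exp (- ((1 + \<epsilon>) * inverse (zeta d L \<rho> n) * \<rho> r)) else 0)" for r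
        have F: "0 \<le> F" using a B cn0 by (simp add: F_def)
        have h_power: "h (real L ^ i) =
            (if i \<le> n - k then 1 - exp (- ((1 + \<epsilon>) * crit_weight d L \<rho> n i)) else 0)" for i
          using L by (simp add: h_def crit_weight_def mult.assoc)
        have h0: "0 \<le> h (real L ^ i)" for i
          using crit_weight_bounds(1)[OF L d n4 A(1) \<rho>, of i] \<epsilon> by (simp add: h_power)
        have p_le: "?p y \<le> h (hier_dist d L x y) + F" and h_dist: "0 \<le> h (hier_dist d L x y)"
          if y: "y \<in> ?\<Lambda>" "y \<noteq> x" for y
        proof -
          obtain i where i: "1 \<le> i" "i \<le> n" "hier_dist d L x y = real L ^ i"
            using hier_dist_power[OF L x y] .
          have p: "?p y = 1 - exp (- ((1 + \<epsilon>) * crit_weight d L \<rho> n i))"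
            using edge_prob_near_critical[OF x y(1)] y i by (simp add: crit_weight_def mult.assoc)
          show "0 \<le> h (hier_dist d L x y)" unfolding i(3) by (rule h0)
          show "?p y \<le> h (hier_dist d L x y) + F"
          proof (cases "i \<le> n - k")
            case True
            then show ?thesis using F unfolding p i(3) h_power by simp
          next
            case False
            then have "a ^ i \<le> a ^ (n - k)" using a by (intro power_decreasing) auto
            then have "f i \<le> F" unfolding f_def F_def
              using B cn0 by (intro divide_right_mono mult_left_mono) auto
            then show ?thesis using conn[of i] False unfolding p i(3) h_power by simp
          qed
        qed
        have "(\<Sum>y\<in>R - {x}. ?p y) \<le> (\<Sum>y\<in>R - {x}. h (hier_dist d L x y) + F)"
          using R by (intro sum_mono p_le) auto
        also have "\<dots> = (\<Sum>y\<in>R - {x}. h (hier_dist d L x y)) + real (card (R - {x})) * F"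
          by (simp add: sum.distrib)
        also have "(\<Sum>y\<in>R - {x}. h (hier_dist d L x y)) \<le> (\<Sum>y\<in>?\<Lambda> - {x}. h (hier_dist d L x y))"
          using R card_hier_ball(2)[OF L] h_dist by (intro sum_mono2) auto
        also have "\<dots> = (\<Sum>i=1..n. sphere_card d L i * h (real L ^ i))"
          by (rule sum_hier_dist[OF L x])
        also have "\<dots> = (\<Sum>i=1..n - k. sphere_card d L i * (1 - exp (- ((1 + \<epsilon>) * crit_weight d L \<rho> n i))))"
          unfolding h_power by (intro sum.mono_neutral_cong_right) auto
        also have "\<dots> \<le> (\<Sum>i=1..n - k. sphere_card d L i * f i)"
          by (intro sum_mono mult_left_mono conn sphere_card_nonneg L)
        also have "\<dots> \<le> \<eta> / 2" by (rule near)
        also have "real (card (R - {x})) * F \<le> \<theta> * ?N * F"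
        proof (rule mult_right_mono[OF _ F])
          have "card (R - {x}) \<le> card R" by (rule card_Diff1_le)
          then show "real (card (R - {x})) \<le> \<theta> * ?N" using card by linarith
        qed
        also have "\<dots> \<le> (\<eta> / 2 * a ^ k / B) * ?N * F"
          using F by (intro mult_right_mono) (auto simp: \<theta>_def)
        also have "\<dots> = \<eta> / 2"
        proof -
          have "a ^ k * a ^ (n - k) = a ^ n" using elim(2) by (simp add: power_add[symmetric])
          then have "(\<eta> / 2 * a ^ k / B) * ?N * F = \<eta> / 2 * (?N * a ^ n) / c ^ n"
            unfolding F_def using B by (simp add: field_simps)
          then show ?thesis unfolding cn[symmetric] using a(3) by auto
        qed
        finally show "(\<Sum>y\<in>R - {x}. ?p y) \<le> \<eta>" by simp
      qed
    qed
  qed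
qed

text \<open>An increment with mean \<open>\<mu> - 1 > 0\<close> lowers \<open>z ^ S\<close> in the mean when \<open>z\<close> is slightly below one: for
  \<open>u = 1 - z\<close>, \<open>exp (u \<mu>) (1 - u) \<ge> (1 + u \<mu>) (1 - u)\<close>, which exceeds one if \<open>u \<mu> < \<mu> - 1\<close>.\<close>

lemma exponential_drift:
  fixes \<mu> :: real
  assumes "1 < \<mu>"
  obtains z q where "0 < z" "z < 1" "0 < q" "q < 1" "exp (- (1 - z) * \<mu>) \<le> q * z"
proof -
  define u where "u = (\<mu> - 1) / (2 * \<mu>)"
  have u: "0 < u" "u < 1" "u * \<mu> = (\<mu> - 1) / 2" using assms by (auto simp: u_def field_simps)
  have "1 < (1 + u * \<mu>) * (1 - u)"
  proof -
    have "(1 + u * \<mu>) * (1 - u) = 1 + u * (\<mu> - 1 - u * \<mu>)" by (simp add: algebra_simps)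
    moreover have "\<mu> - 1 - u * \<mu> = (\<mu> - 1) / 2" unfolding u(3) by (simp add: field_simps)
    then have "0 < u * (\<mu> - 1 - u * \<mu>)" using u assms by simp
    ultimately show ?thesis by linarith
  qed
  moreover have "1 + u * \<mu> \<le> exp (u * \<mu>)" by (rule exp_ge_add_one_self)
  then have "(1 + u * \<mu>) * (1 - u) \<le> exp (u * \<mu>) * (1 - u)" using u by (intro mult_right_mono) auto
  ultimately have "1 < exp (u * \<mu>) * (1 - u)" by linarith
  then have "exp (- (u * \<mu>)) / (1 - u) < 1"
    using u by (simp add: exp_minus field_simps)
  then show thesis
    using u(1,2) by (intro that[of "1 - u" "exp (- (u * \<mu>)) / (1 - u)"]) auto
qed

section \<open>The two regimes\<close>

text \<open>The expected degrees are eventually at most \<open>1 - \<eta>\<close> with \<open>\<eta> = \<epsilon> / 2\<close>. The constant \<open>16\<close> cancels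
  \<open>\<eta>\<^sup>2 / 4 = \<epsilon>\<^sup>2 / 16\<close>; the term \<open>d ln L\<close> compensates the number \<open>L ^ (n * d)\<close> of vertices, and the
  summand \<open>1\<close> leaves a factor \<open>exp (- n)\<close>.\<close>

lemma subcritical_component:
  assumes d: "d \<ge> 1" and L: "L \<ge> 2" and \<alpha>: "0 < \<alpha>" "\<alpha> < real d"
    and A: "0 < A\<^sub>1" "A\<^sub>1 \<le> A\<^sub>2" and \<rho>: "admissible_rho \<alpha> A\<^sub>1 A\<^sub>2 \<rho>" and \<epsilon>: "0 < \<epsilon>" "\<epsilon> < 1"
  shows "(\<lambda>n. measure_pmf.prob
      (random_graph (hier_ball d L n) (near_critical_kernel d L \<rho> (-\<epsilon>) n))
      {E. real (card (largest_component (hier_ball d L n) E)) \<le> 16 * (real d * ln L + 1) * real n / \<epsilon>\<^sup>2})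
    \<longlonglongrightarrow> 1"
    (is "(\<lambda>n. measure_pmf.prob (?P n) {E. ?S n E \<le> ?m n}) \<longlonglongrightarrow> 1")
proof (rule tendsto_sandwich[where f = "\<lambda>n. 1 - 2 * exp (- 1) ^ n" and h = "\<lambda>_. 1"])
  show "\<forall>\<^sub>F n in sequentially. 1 - 2 * exp (- 1) ^ n \<le> measure_pmf.prob (?P n) {E. ?S n E \<le> ?m n}"
    using eventually_hier_ball_large[OF L d, of 4] subcritical_degree[OF L d \<alpha> A \<rho> \<epsilon>]
  proof eventually_elim
    case (elim n)
    let ?V = "hier_ball d L n"
    have n4: "L ^ (n * d) \<ge> 4"
      using elim(1) by (metis of_nat_le_iff of_nat_numeral of_nat_power)
    have "measure_pmf.prob (?P n) {E. ?S n E > ?m n}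
        \<le> real (card ?V) * (2 * exp (- (\<epsilon> / 2)\<^sup>2 / 4 * ?m n))"
      unfolding random_graph_eq_random_edges
    proof (rule prob_large_component_le)
      show "?V \<noteq> {}" using card_hier_ball(1)[OF L, of d n] n4 L by auto
      show "0 \<le> edge_prob (near_critical_kernel d L \<rho> (-\<epsilon>) n) e \<and>
        edge_prob (near_critical_kernel d L \<rho> (-\<epsilon>) n) e \<le> 1" if "e \<in> vertex_pairs ?V" for e
        using n4 \<epsilon> that by (intro edge_prob_near_critical_bounds[OF L d _ A(1) \<rho>]) auto
      show "(\<Sum>y\<in>?V - {x}. edge_prob (near_critical_kernel d L \<rho> (-\<epsilon>) n) {x, y}) \<le> 1 - \<epsilon> / 2"
        if "x \<in> ?V" for x
        using elim(2) sum_edge_prob_near_critical[OF L that, of \<rho> "-\<epsilon>"] by simp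
    qed (use card_hier_ball(2)[OF L] \<epsilon> L in auto)
    also have "real (card ?V) = exp (real n * (real d * ln L))"
      using L by (simp add: card_hier_ball[OF L] exp_of_nat_mult power_mult exp_ln mult.commute[of n d])
    also have "- (\<epsilon> / 2)\<^sup>2 / 4 * ?m n = - (real n * (real d * ln L)) - real n"
      using \<epsilon> by (simp add: field_simps power2_eq_square)
    also have "exp (real n * (real d * ln L)) * (2 * exp (- (real n * (real d * ln L)) - real n)) =
        2 * exp (- 1) ^ n"
      by (simp add: exp_diff exp_minus field_simps exp_of_nat_mult[symmetric])
    finally have "measure_pmf.prob (?P n) {E. ?S n E > ?m n} \<le> 2 * exp (- 1) ^ n" .
    moreover have "measure_pmf.prob (?P n) {E. ?S n E \<le> ?m n} =
        1 - measure_pmf.prob (?P n) {E. ?S n E > ?m n}"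
      using measure_pmf.prob_compl[of "{E. ?S n E > ?m n}" "?P n"]
      by (simp add: set_diff_eq not_less)
    ultimately show ?case by linarith
  qed
  have "(\<lambda>n. exp (- 1 :: real) ^ n) \<longlonglongrightarrow> 0" by (intro LIMSEQ_realpow_zero) auto
  from tendsto_diff[OF tendsto_const[of 1] tendsto_mult_left[OF this, of 2]]
  show "(\<lambda>n. 1 - 2 * exp (- 1 :: real) ^ n) \<longlonglongrightarrow> 1" by simp
qed auto

text \<open>After \<open>w * M\<close> steps the bound is \<open>q ^ (w * M) / z ^ M\<close>, which is at most \<open>z ^ M\<close> if \<open>q ^ w \<le> z\<^sup>2\<close>.
  By then at most \<open>w * M + M\<close> vertices have been discovered, which is within the tolerance \<open>\<theta> * N\<close>
  of \<open>degree_loss_le\<close> for \<open>M = \<lceil>C * N\<rceil>\<close>; half of \<open>\<theta>\<close> is reserved for the rounding. Of the surplus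
  \<open>\<epsilon> / 2\<close> in the expected degrees, \<open>\<epsilon> / 4\<close> is given up for the discovered vertices.\<close>

lemma supercritical_component:
  assumes d: "d \<ge> 1" and L: "L \<ge> 2" and \<alpha>: "0 < \<alpha>" "\<alpha> < real d"
    and A: "0 < A\<^sub>1" "A\<^sub>1 \<le> A\<^sub>2" and \<epsilon>: "0 < \<epsilon>"
  shows "\<exists>C>0. \<forall>\<rho>. admissible_rho \<alpha> A\<^sub>1 A\<^sub>2 \<rho> \<longrightarrow>
    (\<lambda>n. measure_pmf.prob
      (random_graph (hier_ball d L n) (near_critical_kernel d L \<rho> \<epsilon> n))
      {E. real (card (largest_component (hier_ball d L n) E)) \<ge> C * real L ^ (n * d)})
    \<longlonglongrightarrow> 1"
proof -
  obtain z q where z: "0 < z" "z < 1" and q: "0 < q" "q < 1"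
    and zq: "exp (- (1 - z) * (1 + \<epsilon> / 4)) \<le> q * z"
    using exponential_drift[of "1 + \<epsilon> / 4"] \<epsilon> by auto
  have "(\<lambda>w. q ^ w) \<longlonglongrightarrow> 0" using q by (intro LIMSEQ_realpow_zero) auto
  then have "\<forall>\<^sub>F w in sequentially. q ^ w < z ^ 2" using z by (intro order_tendstoD) auto
  then obtain w where w: "q ^ w < z ^ 2" by (auto simp: eventually_sequentially)
  have "\<epsilon> / 4 > 0" using \<epsilon> by simp
  from degree_loss_le[OF L d \<alpha> A this \<epsilon>] obtain \<theta> where \<theta>: "0 < \<theta>" "\<theta> < 1"
    and loss: "\<And>\<rho>. admissible_rho \<alpha> A\<^sub>1 A\<^sub>2 \<rho> \<Longrightarrow>
      \<forall>\<^sub>F n in sequentially. \<forall>x\<in>hier_ball d L n. \<forall>R\<subseteq>hier_ball d L n.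
      real (card R) \<le> \<theta> * real L ^ (n * d) \<longrightarrow>
      (\<Sum>y\<in>R - {x}. edge_prob (near_critical_kernel d L \<rho> \<epsilon> n) {x, y}) \<le> \<epsilon> / 4"
    by blast
  define C where "C = \<theta> / (2 * (real w + 1))"
  have C: "C > 0" using \<theta> by (simp add: C_def)
  show ?thesis
  proof (intro exI[of _ C] conjI C allI impI)
    fix \<rho> assume \<rho>: "admissible_rho \<alpha> A\<^sub>1 A\<^sub>2 \<rho>"
    let ?V = "hier_ball d L" and ?N = "\<lambda>n. real L ^ (n * d)"
    let ?P = "\<lambda>n. random_graph (?V n) (near_critical_kernel d L \<rho> \<epsilon> n)"
    let ?S = "\<lambda>n E. card (largest_component (?V n) E)"
    define M where "M n = nat \<lceil>C * ?N n\<rceil>" for n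
    show "(\<lambda>n. measure_pmf.prob (?P n) {E. real (?S n E) \<ge> C * ?N n}) \<longlonglongrightarrow> 1"
    proof (rule tendsto_sandwich[where f = "\<lambda>n. 1 - z ^ M n" and h = "\<lambda>_. 1"])
      show "\<forall>\<^sub>F n in sequentially. 1 - z ^ M n \<le> measure_pmf.prob (?P n) {E. real (?S n E) \<ge> C * ?N n}"
        using eventually_hier_ball_large[OF L d, of 4] loss[OF \<rho>]
          supercritical_degree[OF L d \<alpha> A \<rho> \<epsilon>]
          eventually_hier_ball_large[OF L d, of "2 * (real w + 1) / \<theta>"]
      proof eventually_elim
        case (elim n)
        define r where "r = nat \<lfloor>\<theta> * ?N n\<rfloor>"
        have n4: "L ^ (n * d) \<ge> 4"
          using elim(1) by (metis of_nat_le_iff of_nat_numeral of_nat_power)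
        have N: "?N n > 0" using L by simp
        have r: "real r \<le> \<theta> * ?N n" using \<theta> N by (simp add: r_def)
        also have "\<dots> < ?N n" using \<theta> N by simp
        finally have rV: "r < card (?V n)"
          by (metis card_hier_ball(1)[OF L] of_nat_less_iff of_nat_power)
        have "real (M n) \<le> C * ?N n + 1" 
        proof -
          have "0 \<le> \<lceil>C * ?N n\<rceil>" using C N by (simp add: less_le_trans[of "-1" 0])
          then show ?thesis unfolding M_def by (simp add: of_nat_nat of_int_ceiling_le_add_one)
        qed
        then have "(real w + 1) * real (M n) \<le> (real w + 1) * (C * ?N n + 1)"
          by (intro mult_left_mono) auto
        also have "\<dots> = \<theta> * ?N n / 2 + (real w + 1)"
          by (simp add: C_def field_simps)
        also have "\<dots> \<le> \<theta> * ?N n"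
          using elim(4) \<theta> by (simp add: field_simps)
        finally have "real (w * M n + M n) \<le> \<theta> * ?N n" by (simp add: algebra_simps)
        then have t: "w * M n + M n \<le> r"
          unfolding r_def using \<theta> N by (simp add: le_nat_floor)
        have "measure_pmf.prob (?P n) {E. ?S n E < M n} \<le> q ^ (w * M n) / z ^ M n"
          unfolding random_graph_eq_random_edges
        proof (rule prob_no_large_component_le[OF card_hier_ball(2)[OF L] rV _ _ z q(1) zq t])
          show "0 \<le> edge_prob (near_critical_kernel d L \<rho> \<epsilon> n) e \<and>
            edge_prob (near_critical_kernel d L \<rho> \<epsilon> n) e \<le> 1" if "e \<in> vertex_pairs (?V n)" for e
            using n4 \<epsilon> that by (intro edge_prob_near_critical_bounds[OF L d _ A(1) \<rho>]) auto
          fix x R assume x: "x \<in> ?V n" and R: "R \<subseteq> ?V n" "card R \<le> r"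
          let ?p = "\<lambda>y. edge_prob (near_critical_kernel d L \<rho> \<epsilon> n) {x, y}"
          have "real (card R) \<le> \<theta> * ?N n" using R(2) r by linarith
          then have "(\<Sum>y\<in>R - {x}. ?p y) \<le> \<epsilon> / 4" using elim(2) x R(1) by blast
          moreover have "1 + \<epsilon> / 2 \<le> (\<Sum>y\<in>?V n - {x}. ?p y)"
            using elim(3) sum_edge_prob_near_critical[OF L x, of \<rho> \<epsilon>] by simp
          moreover have "(\<Sum>y\<in>?V n - {x}. ?p y) = (\<Sum>y\<in>?V n - {x} - (R - {x}). ?p y) + (\<Sum>y\<in>R - {x}. ?p y)"
            using R card_hier_ball(2)[OF L] by (intro sum.subset_diff) auto
          moreover have "?V n - {x} - (R - {x}) = ?V n - R - {x}" by auto
          ultimately show "1 + \<epsilon> / 4 \<le> (\<Sum>y\<in>?V n - R - {x}. ?p y)" by simp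
        qed
        also have "q ^ (w * M n) / z ^ M n \<le> (z ^ 2) ^ M n / z ^ M n"
          unfolding power_mult using w z q by (intro divide_right_mono power_mono) auto
        also have "\<dots> = z ^ M n"
          using z by (simp add: power2_eq_square power_mult_distrib)
        finally have small: "measure_pmf.prob (?P n) {E. ?S n E < M n} \<le> z ^ M n" .
        have "measure_pmf.prob (?P n) {E. real (?S n E) < C * ?N n} \<le> measure_pmf.prob (?P n) {E. ?S n E < M n}"
        proof (rule measure_pmf.finite_measure_mono)
          show "{E. real (?S n E) < C * ?N n} \<subseteq> {E. ?S n E < M n}"
            unfolding M_def by (auto simp: zless_nat_eq_int_zless less_ceiling_iff)
        qed simp
        moreover have "measure_pmf.prob (?P n) {E. real (?S n E) \<ge> C * ?N n} =
            1 - measure_pmf.prob (?P n) {E. real (?S n E) < C * ?N n}"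
          using measure_pmf.prob_compl[of "{E. real (?S n E) < C * ?N n}" "?P n"]
          by (simp add: set_diff_eq not_less)
        ultimately show ?case using small by linarith
      qed
      have "filterlim M at_top sequentially"
        unfolding filterlim_at_top
      proof
        fix K
        show "\<forall>\<^sub>F n in sequentially. K \<le> M n"
          using eventually_hier_ball_large[OF L d, of "real K / C"]
        proof eventually_elim
          case (elim n)
          then have "real K \<le> C * ?N n" using C by (simp add: field_simps)
          then show ?case unfolding M_def using real_nat_ceiling_ge[of "C * ?N n"] by linarith
        qed
      qed
      then have "(\<lambda>n. z ^ M n) \<longlonglongrightarrow> 0"
        using z by (intro filterlim_compose[OF LIMSEQ_realpow_zero]) auto
      from tendsto_diff[OF tendsto_const[of 1] this]
      show "(\<lambda>n. 1 - z ^ M n) \<longlonglongrightarrow> 1" by simp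
    qed auto
  qed
qed

theorem proposition2p1:
  fixes d L :: nat
  assumes "d \<ge> 1" and "L \<ge> 2"
  shows
    "(\<exists>C>0. \<forall>\<alpha> A\<^sub>1 A\<^sub>2 \<rho>. 0 < \<alpha> \<and> \<alpha> < real d \<and> 0 < A\<^sub>1 \<and> A\<^sub>1 \<le> A\<^sub>2 \<and> admissible_rho \<alpha> A\<^sub>1 A\<^sub>2 \<rho> \<longrightarrow>
       (\<forall>\<epsilon>. 0 < \<epsilon> \<and> \<epsilon> < 1 \<longrightarrow>
          (\<lambda>n. measure_pmf.prob
             (random_graph (hier_ball d L n) (near_critical_kernel d L \<rho> (-\<epsilon>) n))
             {E. real (card (largest_component (hier_ball d L n) E)) \<le> C * real n / \<epsilon>\<^sup>2})
          \<longlonglongrightarrow> 1))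
     \<and>
     (\<forall>\<epsilon> \<alpha> A\<^sub>1 A\<^sub>2. 0 < \<epsilon> \<and> 0 < \<alpha> \<and> \<alpha> < real d \<and> 0 < A\<^sub>1 \<and> A\<^sub>1 \<le> A\<^sub>2 \<longrightarrow>
       (\<exists>C>0. \<forall>\<rho>. admissible_rho \<alpha> A\<^sub>1 A\<^sub>2 \<rho> \<longrightarrow>
          (\<lambda>n. measure_pmf.prob
             (random_graph (hier_ball d L n) (near_critical_kernel d L \<rho> \<epsilon> n))
             {E. real (card (largest_component (hier_ball d L n) E)) \<ge> C * real L ^ (n * d)})
          \<longlonglongrightarrow> 1))"
proof (intro conjI)
  have "0 < 16 * (real d * ln L + 1)" using assms by (intro mult_pos_pos add_nonneg_pos) auto
  then show "\<exists>C>0. \<forall>\<alpha> A\<^sub>1 A\<^sub>2 \<rho>. 0 < \<alpha> \<and> \<alpha> < real d \<and> 0 < A\<^sub>1 \<and> A\<^sub>1 \<le> A\<^sub>2 \<and> admissible_rho \<alpha> A\<^sub>1 A\<^sub>2 \<rho> \<longrightarrow>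
       (\<forall>\<epsilon>. 0 < \<epsilon> \<and> \<epsilon> < 1 \<longrightarrow>
          (\<lambda>n. measure_pmf.prob
             (random_graph (hier_ball d L n) (near_critical_kernel d L \<rho> (-\<epsilon>) n))
             {E. real (card (largest_component (hier_ball d L n) E)) \<le> C * real n / \<epsilon>\<^sup>2})
          \<longlonglongrightarrow> 1)"
    using subcritical_component[OF assms] by blast
qed (use supercritical_component[OF assms] in blast)

end
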